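(* Let $p\in\mathbb C[z,w]$ be a non-zero homogeneous polynomial of total degree $D\ge1$, let $\mathcal Q_p=H^2(\mathbb D^2)\ominus[p]$, and let $Y_p=[S_z^*,S_w]=S_z^*S_w-S_wS_z^*$ on $\mathcal Q_p$. The operator $Y_p$ vanishes on $\bigoplus_{m=0}^{D-2}H_m$ (an empty sum if $D=1$). For every $n\ge0$ the subspace $\mathcal Q_{D+n-1}=\mathcal Q_p\cap H_{D+n-1}$ reduces $Y_p$, and the restriction of $Y_p$ to $\mathcal Q_{D+n-1}$ has rank at most one. Its only possible non-zero singular value is $$\beta_0(p)=\sqrt{(1-a_q)(1-b_q)}\qquad (n=0),$$ $$\beta_n(p)=|\alpha_{n-1}|\sqrt{(1-a_q\kappa_n^2)(1-b_q\kappa_n^2)}\qquad (n\ge1).$$ Consequently, after zero terms are removed, the non-zero singular values of $Y_p$ form the multiset $\{\beta_0(p),\beta_1(p),\beta_2(p),\ldots\}$ (before decreasing rearrangement).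
   Context: $H^2(\mathbb D^2)$ is the Hardy space of the bidisc, $[p]$ the closure of $p\,\mathbb C[z,w]$ in it, and $H_n=\operatorname{span}\{z^jw^{n-j}:0\le j\le n\}$. $S_z=P_{\mathcal Q_p}M_z|_{\mathcal Q_p}$ and $S_w=P_{\mathcal Q_p}M_w|_{\mathcal Q_p}$ are the compressions of multiplication by $z$ and $w$. Note that $\mathcal Q_{D-1}=H_{D-1}$. Write $q(\zeta)=p(\zeta,1)=\sum_{j=0}^Dq_j\zeta^j$ (the coefficients $q_0,q_D$ may vanish), $\|q\|_2$ for the norm of $L^2(\mathbb T,m)$ with $m$ normalized Haar measure, $a_q=|q_0|^2/\|q\|_2^2$, $b_q=|q_D|^2/\|q\|_2^2$. Let $d\mu=\frac{|q|^2}{\|q\|_2^2}dm$ on $\mathbb T$, let $(\varphi_n)_{n\ge0}$ be its orthonormal polynomials with leading coefficients $\kappa_n>0$, $\varphi_n^*(\zeta)=\zeta^n\overline{\varphi_n(1/\overline\zeta)}$, and let the Verblunsky coefficients $\alpha_n\in\mathbb D$ be defined by $\rho_n\varphi_{n+1}(\zeta)=\zeta\varphi_n(\zeta)-\overline{\alpha_n}\varphi_n^*(\zeta)$, $\rho_n=(1-|\alpha_n|^2)^{1/2}$. *)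

theory Defs
  imports "HOL-Analysis.Analysis" "HOL-Computational_Algebra.Polynomial"
begin

section \<open>The Hardy space of the bidisc\<close>

text \<open>
  An element $\sum_{i,j} a_{ij} z^i w^j$ of $H^2(\mathbb D^2)$ is represented by its family of
  Taylor coefficients, which may be any square-summable family; the pair \<open>(i, j)\<close> stands for
  the monomial $z^i w^j$.
\<close>

typedef hardy = "{a :: nat \<times> nat \<Rightarrow> complex. (\<lambda>k. (cmod (a k))\<^sup>2) summable_on UNIV}"
  morphisms hcoeff Abs_hardy
  by (rule exI[of _ "\<lambda>_. 0"]) simp

setup_lifting type_definition_hardy

lemma sq_summable_add:
  fixes a b :: "'i \<Rightarrow> complex"
  assumes "(\<lambda>k. (cmod (a k))\<^sup>2) summable_on UNIV" "(\<lambda>k. (cmod (b k))\<^sup>2) summable_on UNIV"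
  shows "(\<lambda>k. (cmod (a k + b k))\<^sup>2) summable_on UNIV"
proof (rule summable_on_comparison_test)
  show "(\<lambda>k. 2 * (cmod (a k))\<^sup>2 + 2 * (cmod (b k))\<^sup>2) summable_on UNIV"
    by (intro summable_on_add summable_on_cmult_right assms)
  show "(cmod (a k + b k))\<^sup>2 \<le> 2 * (cmod (a k))\<^sup>2 + 2 * (cmod (b k))\<^sup>2" for k
  proof -
    have "(cmod (a k + b k))\<^sup>2 \<le> (cmod (a k) + cmod (b k))\<^sup>2"
      by (intro power_mono norm_triangle_ineq) simp
    also have "\<dots> \<le> 2 * (cmod (a k))\<^sup>2 + 2 * (cmod (b k))\<^sup>2"
      using sum_squares_bound[of "cmod (a k)" "cmod (b k)"] by (simp add: power2_sum)
    finally show ?thesis .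
  qed
qed simp

lemma sq_summable_scale:
  fixes a :: "'i \<Rightarrow> complex"
  assumes "(\<lambda>k. (cmod (a k))\<^sup>2) summable_on UNIV"
  shows "(\<lambda>k. (cmod (c * a k))\<^sup>2) summable_on UNIV"
  using summable_on_cmult_right[OF assms, of "(cmod c)\<^sup>2"] by (simp add: norm_mult power_mult_distrib)

lemma sq_summable_inner:
  fixes a b :: "'i \<Rightarrow> complex"
  assumes "(\<lambda>k. (cmod (a k))\<^sup>2) summable_on UNIV" "(\<lambda>k. (cmod (b k))\<^sup>2) summable_on UNIV"
  shows "(\<lambda>k. a k * cnj (b k)) summable_on UNIV"
proof (rule abs_summable_summable, rule summable_on_comparison_test)
  show "(\<lambda>k. (cmod (a k))\<^sup>2 + (cmod (b k))\<^sup>2) summable_on UNIV"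
    by (intro summable_on_add assms)
  show "norm (a k * cnj (b k)) \<le> (cmod (a k))\<^sup>2 + (cmod (b k))\<^sup>2" for k
  proof -
    have "cmod (a k) * cmod (b k) \<le> 2 * cmod (a k) * cmod (b k)" by simp
    also have "\<dots> \<le> (cmod (a k))\<^sup>2 + (cmod (b k))\<^sup>2"
      by (rule sum_squares_bound)
    finally show ?thesis by (simp add: norm_mult)
  qed
qed simp

instantiation hardy :: real_inner
begin

lift_definition zero_hardy :: hardy is "\<lambda>_. 0" by simp
lift_definition plus_hardy :: "hardy \<Rightarrow> hardy \<Rightarrow> hardy" is "\<lambda>a b k. a k + b k"
  by (rule sq_summable_add)
lift_definition uminus_hardy :: "hardy \<Rightarrow> hardy" is "\<lambda>a k. - a k" by simp
lift_definition minus_hardy :: "hardy \<Rightarrow> hardy \<Rightarrow> hardy" is "\<lambda>a b k. a k - b k"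
  subgoal for a b using sq_summable_add[of a "\<lambda>k. - b k"] by simp
  done
lift_definition scaleR_hardy :: "real \<Rightarrow> hardy \<Rightarrow> hardy" is "\<lambda>r a k. of_real r * a k"
  by (rule sq_summable_scale)
lift_definition inner_hardy :: "hardy \<Rightarrow> hardy \<Rightarrow> real"
  is "\<lambda>a b. Re (\<Sum>\<^sub>\<infinity>k. a k * cnj (b k))" .

definition norm_hardy :: "hardy \<Rightarrow> real" where "norm_hardy f = sqrt (f \<bullet> f)"
definition sgn_hardy :: "hardy \<Rightarrow> hardy" where "sgn_hardy f = inverse (norm f) *\<^sub>R f"
definition dist_hardy :: "hardy \<Rightarrow> hardy \<Rightarrow> real" where "dist_hardy f g = norm (f - g)"
definition uniformity_hardy :: "(hardy \<times> hardy) filter"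
  where "uniformity_hardy = (INF e\<in>{0<..}. principal {(f, g). dist f g < e})"
definition open_hardy :: "hardy set \<Rightarrow> bool"
  where "open_hardy U = (\<forall>x\<in>U. \<forall>\<^sub>F (x', y) in uniformity. x' = x \<longrightarrow> y \<in> U)"

instance
proof
  fix f g h :: hardy and r s :: real
  show "f + g + h = f + (g + h)" by transfer (simp add: add.assoc)
  show "f + g = g + f" by transfer (simp add: add.commute)
  show "0 + f = f" by transfer simp
  show "- f + f = 0" by transfer simp
  show "f - g = f + - g" by transfer simp
  show "r *\<^sub>R (f + g) = r *\<^sub>R f + r *\<^sub>R g" by transfer (simp add: algebra_simps)
  show "(r + s) *\<^sub>R f = r *\<^sub>R f + s *\<^sub>R f" by transfer (simp add: algebra_simps)
  show "r *\<^sub>R s *\<^sub>R f = (r * s) *\<^sub>R f" by transfer (simp add: algebra_simps)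
  show "1 *\<^sub>R f = f" by transfer simp
  show "dist f g = norm (f - g)" by (rule dist_hardy_def)
  show "sgn f = inverse (norm f) *\<^sub>R f" by (rule sgn_hardy_def)
  show "uniformity = (INF e\<in>{0<..}. principal {(f, g :: hardy). dist f g < e})"
    by (rule uniformity_hardy_def)
  show "open U = (\<forall>x\<in>U. \<forall>\<^sub>F (x', y) in uniformity. x' = x \<longrightarrow> y \<in> U)" for U :: "hardy set"
    by (rule open_hardy_def)
  show "f \<bullet> g = g \<bullet> f"
  proof transfer
    fix a b :: "nat \<times> nat \<Rightarrow> complex"
    have "(\<Sum>\<^sub>\<infinity>k. a k * cnj (b k)) = cnj (\<Sum>\<^sub>\<infinity>k. b k * cnj (a k))"
      by (subst infsum_cnj[symmetric]) (simp add: mult.commute)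
    then show "Re (\<Sum>\<^sub>\<infinity>k. a k * cnj (b k)) = Re (\<Sum>\<^sub>\<infinity>k. b k * cnj (a k))" by simp
  qed
  show "(f + g) \<bullet> h = f \<bullet> h + g \<bullet> h"
    by transfer (simp add: distrib_right infsum_add sq_summable_inner)
  show "r *\<^sub>R f \<bullet> g = r * (f \<bullet> g)"
    by transfer (simp add: mult.assoc infsum_cmult_right')
  show "0 \<le> f \<bullet> f"
  proof transfer
    fix a :: "nat \<times> nat \<Rightarrow> complex"
    assume "(\<lambda>k. (cmod (a k))\<^sup>2) summable_on UNIV"
    then have "Re (\<Sum>\<^sub>\<infinity>k. a k * cnj (a k)) = (\<Sum>\<^sub>\<infinity>k. Re (a k * cnj (a k)))"
      by (intro infsum_Re[symmetric] sq_summable_inner)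
    also have "\<dots> \<ge> 0" by (rule infsum_nonneg) simp
    finally show "0 \<le> Re (\<Sum>\<^sub>\<infinity>k. a k * cnj (a k))" .
  qed
  show "f \<bullet> f = 0 \<longleftrightarrow> f = 0"
  proof transfer
    fix a :: "nat \<times> nat \<Rightarrow> complex"
    assume a: "(\<lambda>k. (cmod (a k))\<^sup>2) summable_on UNIV"
    have eq: "Re (\<Sum>\<^sub>\<infinity>k. a k * cnj (a k)) = (\<Sum>\<^sub>\<infinity>k. (cmod (a k))\<^sup>2)"
      unfolding infsum_Re[OF sq_summable_inner[OF a a], symmetric]
      by (intro infsum_cong) (simp add: cmod_power2, simp add: power2_eq_square)
    show "Re (\<Sum>\<^sub>\<infinity>k. a k * cnj (a k)) = 0 \<longleftrightarrow> a = (\<lambda>_. 0)"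
    proof
      assume "Re (\<Sum>\<^sub>\<infinity>k. a k * cnj (a k)) = 0"
      then have "(cmod (a k))\<^sup>2 = 0" for k
        using nonneg_infsum_le_0D[of "\<lambda>k. (cmod (a k))\<^sup>2" UNIV k] a eq by simp
      then show "a = (\<lambda>_. 0)" by auto
    qed simp
  qed
  show "norm f = sqrt (f \<bullet> f)" by (rule norm_hardy_def)
qed

end

lift_definition cinner :: "hardy \<Rightarrow> hardy \<Rightarrow> complex"
  is "\<lambda>a b. \<Sum>\<^sub>\<infinity>k. a k * cnj (b k)" .

lift_definition cscale :: "complex \<Rightarrow> hardy \<Rightarrow> hardy" (infixr "*\<^sub>C" 75) is "\<lambda>c a k. c * a k"
  by (rule sq_summable_scale)

global_interpretation hardy: vector_space cscale
  defines cspan = hardy.span and csubspace = hardy.subspace and cdependent = hardy.dependent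
  by unfold_locales (transfer; simp add: algebra_simps)+

text \<open>\<open>has_cdim V k\<close>: \<open>V\<close> is a finite-dimensional complex subspace of dimension exactly \<open>k\<close>.\<close>

definition has_cdim :: "hardy set \<Rightarrow> nat \<Rightarrow> bool"
  where "has_cdim V k \<longleftrightarrow> (\<exists>B. finite B \<and> \<not> cdependent B \<and> cspan B = V \<and> card B = k)"

definition hperp :: "hardy set \<Rightarrow> hardy set"
  where "hperp V = {f. \<forall>g\<in>V. cinner f g = 0}"

lift_definition mult_z :: "hardy \<Rightarrow> hardy"
  is "\<lambda>a (i, j). if i = 0 then 0 else a (i - 1, j)"
proof -
  fix a :: "nat \<times> nat \<Rightarrow> complex"
  assume a: "(\<lambda>k. (cmod (a k))\<^sup>2) summable_on UNIV"
  let ?h = "\<lambda>(i::nat, j::nat). (i + 1, j)"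
  let ?b = "\<lambda>k. (cmod (case k of (i, j) \<Rightarrow> if i = 0 then 0 else a (i - 1, j)))\<^sup>2"
  have "?b summable_on range ?h \<longleftrightarrow> (?b \<circ> ?h) summable_on UNIV"
    by (rule summable_on_reindex) (auto simp: inj_on_def)
  also have "?b \<circ> ?h = (\<lambda>k. (cmod (a k))\<^sup>2)" by (auto simp: fun_eq_iff)
  finally have "?b summable_on range ?h" using a by simp
  then show "?b summable_on UNIV"
    by (rule summable_on_cong_neutral[THEN iffD1, rotated -1])
       (auto simp: image_iff gr0_conv_Suc split: if_splits)
qed

lift_definition mult_w :: "hardy \<Rightarrow> hardy"
  is "\<lambda>a (i, j). if j = 0 then 0 else a (i, j - 1)"
proof -
  fix a :: "nat \<times> nat \<Rightarrow> complex"
  assume a: "(\<lambda>k. (cmod (a k))\<^sup>2) summable_on UNIV"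
  let ?h = "\<lambda>(i::nat, j::nat). (i, j + 1)"
  let ?b = "\<lambda>k. (cmod (case k of (i, j) \<Rightarrow> if j = 0 then 0 else a (i, j - 1)))\<^sup>2"
  have "?b summable_on range ?h \<longleftrightarrow> (?b \<circ> ?h) summable_on UNIV"
    by (rule summable_on_reindex) (auto simp: inj_on_def)
  also have "?b \<circ> ?h = (\<lambda>k. (cmod (a k))\<^sup>2)" by (auto simp: fun_eq_iff)
  finally have "?b summable_on range ?h" using a by simp
  then show "?b summable_on UNIV"
    by (rule summable_on_cong_neutral[THEN iffD1, rotated -1])
       (auto simp: image_iff gr0_conv_Suc split: if_splits)
qed

section \<open>Polynomials in two variables\<close>

text \<open>
  $\mathbb C[z,w]$ is the type \<^typ>\<open>complex poly poly\<close>: the outer variable is $w$ and the inner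
  one is $z$, so that $z^i w^j$ has the coefficient \<open>coeff (coeff p j) i\<close> in \<open>p\<close>.
  In particular \<open>poly p 1\<close> is the polynomial $p(\zeta, 1)$ in one variable.
\<close>

definition homogeneous_poly :: "complex poly poly \<Rightarrow> nat \<Rightarrow> bool"
  where "homogeneous_poly p D \<longleftrightarrow> (\<forall>i j. coeff (coeff p j) i \<noteq> 0 \<longrightarrow> i + j = D)"

lift_definition hardy_of_poly :: "complex poly poly \<Rightarrow> hardy"
  is "\<lambda>p (i, j). coeff (coeff p j) i"
proof -
  fix p :: "complex poly poly"
  have "{k. (case k of (i, j) \<Rightarrow> coeff (coeff p j) i) \<noteq> 0}
          \<subseteq> (\<Union>j\<le>degree p. (\<lambda>i. (i, j)) ` {..degree (coeff p j)})"
    by (force intro: le_degree dest: leI simp: coeff_eq_0 image_iff)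
  then have "finite {k. (case k of (i, j) \<Rightarrow> coeff (coeff p j) i) \<noteq> 0}"
    by (rule finite_subset) auto
  then show "(\<lambda>k. (cmod (case k of (i, j) \<Rightarrow> coeff (coeff p j) i))\<^sup>2) summable_on UNIV"
    by (intro finite_nonzero_values_imp_summable_on) simp
qed

definition hmonom :: "nat \<Rightarrow> nat \<Rightarrow> hardy"
  where "hmonom i j = hardy_of_poly (monom (monom 1 i) j)"

definition H_hom :: "nat \<Rightarrow> hardy set"
  where "H_hom n = cspan {hmonom j (n - j) | j. j \<le> n}"

definition submodule_gen :: "complex poly poly \<Rightarrow> hardy set"
  where "submodule_gen p = closure {hardy_of_poly (p * r) | r. True}"

definition Q_mod :: "complex poly poly \<Rightarrow> hardy set"
  where "Q_mod p = hperp (submodule_gen p)"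

definition Q_hom :: "complex poly poly \<Rightarrow> nat \<Rightarrow> hardy set"
  where "Q_hom p m = Q_mod p \<inter> H_hom m"

section \<open>Operators on closed subspaces\<close>

text \<open>
  An operator on a closed subspace \<open>M\<close> is a function \<open>hardy \<Rightarrow> hardy\<close> of which only the
  restriction to \<open>M\<close> matters.  Thus \<open>adj_on M T\<close> is the adjoint of \<open>T\<close> regarded as an
  operator \<open>M \<rightarrow> M\<close>.
\<close>

definition hproj :: "hardy set \<Rightarrow> hardy \<Rightarrow> hardy"
  where "hproj M f = (THE g. g \<in> M \<and> f - g \<in> hperp M)"

definition adj_on :: "hardy set \<Rightarrow> (hardy \<Rightarrow> hardy) \<Rightarrow> hardy \<Rightarrow> hardy"
  where "adj_on M T f = (THE g. g \<in> M \<and> (\<forall>u\<in>M. cinner (T u) f = cinner u g))"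

definition reduces_on :: "hardy set \<Rightarrow> (hardy \<Rightarrow> hardy) \<Rightarrow> hardy set \<Rightarrow> bool"
  where "reduces_on Q T M \<longleftrightarrow>
    csubspace M \<and> closed M \<and> M \<subseteq> Q \<and> T ` M \<subseteq> M \<and> T ` (Q \<inter> hperp M) \<subseteq> Q \<inter> hperp M"

text \<open>
  \<open>sing_value_mult M T s k\<close>: the number \<open>s > 0\<close> occurs with multiplicity exactly \<open>k\<close> among the
  singular values of \<open>T\<close> on \<open>M\<close>, that is, among the square roots of the eigenvalues of
  $T^*T$ counted with multiplicity.  For \<open>k = 0\<close> it says that \<open>s\<close> is not a singular value.
\<close>

definition sing_value_mult :: "hardy set \<Rightarrow> (hardy \<Rightarrow> hardy) \<Rightarrow> real \<Rightarrow> nat \<Rightarrow> bool"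
  where "sing_value_mult M T s k \<longleftrightarrow>
    has_cdim {f \<in> M. adj_on M T (T f) = of_real (s\<^sup>2) *\<^sub>C f} k"

definition S_z :: "complex poly poly \<Rightarrow> hardy \<Rightarrow> hardy"
  where "S_z p f = hproj (Q_mod p) (mult_z f)"

definition S_w :: "complex poly poly \<Rightarrow> hardy \<Rightarrow> hardy"
  where "S_w p f = hproj (Q_mod p) (mult_w f)"

definition Y_op :: "complex poly poly \<Rightarrow> hardy \<Rightarrow> hardy"
  where "Y_op p f =
    adj_on (Q_mod p) (S_z p) (S_w p f) - S_w p (adj_on (Q_mod p) (S_z p) f)"

section \<open>Orthogonal polynomials on the unit circle\<close>

text \<open>Normalized Haar measure of the circle, as a measure on the complex plane.\<close>

definition haar_circle :: "complex measure"
  where "haar_circle = distr (uniform_measure lborel {0..<2 * pi}) borel cis"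

definition circle_norm :: "complex poly \<Rightarrow> real"
  where "circle_norm q = sqrt (LINT \<zeta>|haar_circle. (cmod (poly q \<zeta>))\<^sup>2)"

definition circle_measure :: "complex poly \<Rightarrow> complex measure"
  where "circle_measure q =
    density haar_circle (\<lambda>\<zeta>. ennreal ((cmod (poly q \<zeta>))\<^sup>2 / (circle_norm q)\<^sup>2))"

definition is_orthonormal_polys :: "complex measure \<Rightarrow> (nat \<Rightarrow> complex poly) \<Rightarrow> bool"
  where "is_orthonormal_polys \<mu> \<phi> \<longleftrightarrow>
    (\<forall>n. degree (\<phi> n) = n \<and> (\<exists>\<kappa>>0. lead_coeff (\<phi> n) = complex_of_real \<kappa>)) \<and>
    (\<forall>m n. (LINT \<zeta>|\<mu>. poly (\<phi> m) \<zeta> * cnj (poly (\<phi> n) \<zeta>)) = (if m = n then 1 else 0))"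

definition orthonormal_polys :: "complex measure \<Rightarrow> nat \<Rightarrow> complex poly"
  where "orthonormal_polys \<mu> = (THE \<phi>. is_orthonormal_polys \<mu> \<phi>)"

definition kappa :: "complex measure \<Rightarrow> nat \<Rightarrow> real"
  where "kappa \<mu> n = Re (lead_coeff (orthonormal_polys \<mu> n))"

text \<open>
  The reversed polynomial $\varphi_n^*$, as a function on the complex plane without the origin.
\<close>

definition reversed :: "nat \<Rightarrow> complex poly \<Rightarrow> complex \<Rightarrow> complex"
  where "reversed n \<phi> \<zeta> = \<zeta> ^ n * cnj (poly \<phi> (1 / cnj \<zeta>))"

definition verblunsky :: "complex measure \<Rightarrow> nat \<Rightarrow> complex"
  where "verblunsky \<mu> n = (THE \<alpha>. cmod \<alpha> < 1 \<and> (\<forall>\<zeta>. \<zeta> \<noteq> 0 \<longrightarrow>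
    of_real (sqrt (1 - (cmod \<alpha>)\<^sup>2)) * poly (orthonormal_polys \<mu> (Suc n)) \<zeta> =
      \<zeta> * poly (orthonormal_polys \<mu> n) \<zeta> - cnj \<alpha> * reversed n (orthonormal_polys \<mu> n) \<zeta>))"

text \<open>
  In the following \<open>q\<close> is $p(\zeta, 1)$ and \<open>D\<close> is the total degree of \<open>p\<close>, which may exceed
  the degree of \<open>q\<close>.
\<close>

definition a_par :: "complex poly \<Rightarrow> real"
  where "a_par q = (cmod (coeff q 0))\<^sup>2 / (circle_norm q)\<^sup>2"

definition b_par :: "nat \<Rightarrow> complex poly \<Rightarrow> real"
  where "b_par D q = (cmod (coeff q D))\<^sup>2 / (circle_norm q)\<^sup>2"

definition radicand :: "nat \<Rightarrow> complex poly \<Rightarrow> nat \<Rightarrow> real"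
  where "radicand D q n =
    (if n = 0 then (1 - a_par q) * (1 - b_par D q)
     else (1 - a_par q * (kappa (circle_measure q) n)\<^sup>2)
            * (1 - b_par D q * (kappa (circle_measure q) n)\<^sup>2))"

definition beta :: "nat \<Rightarrow> complex poly poly \<Rightarrow> nat \<Rightarrow> real"
  where "beta D p n =
    (if n = 0 then sqrt (radicand D (poly p 1) 0)
     else cmod (verblunsky (circle_measure (poly p 1)) (n - 1)) * sqrt (radicand D (poly p 1) n))"

end

theory Submission
  imports Defs "HOL-Probability.Probability_Measure"
begin

text \<open>
  Identify $H_d$ with the polynomials of degree at most \<open>d\<close> in $\zeta$, so that $[p] \cap H_{D+n}$ becomes
  $q$ times the polynomials of degree at most \<open>n\<close>.  For $f \in \mathcal Q_p$ the vector $wf$ is orthogonal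
  to $w[p]$, hence its projection to $[p]$ in degree $D+n$ is a multiple of $e_n = q\varphi_n/\|q\|_2$.
  Writing $Y_p f = -P_{\mathcal Q_p} M_z^* P_{[p]} M_w f$ one obtains, in degree $m = D+n-1$,
  $Y_p f = -\langle f, u_m\rangle v_m$ with $u_m = M_w^* e_n$ and $v_m = P_{\mathcal Q_p} M_z^* e_n$.
  The inverse Szego recursion gives $\varphi_n = c\varphi_n^* + \rho_{n-1}\zeta\varphi_{n-1}$ with
  $c = -\overline{\alpha_{n-1}}$ (and $c = 1$ for $n = 0$, without the last term), so
  $v_m = c M_z^*(q\varphi_n^*)/\|q\|_2$.  The backward shifts $M_w^*$ and $M_z^*$
  remove one extreme coefficient from a unit vector, which yields $\|u_m\|^2 = 1 - b_q\kappa_n^2$ and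
  $\|v_m\|^2 = |c|^2(1 - a_q\kappa_n^2)$.
\<close>

section \<open>Orthogonal polynomials on the unit circle\<close>

text \<open>The formula for Y_p rests on three facts. The space Q_p is invariant under M_z^*, so
  S_z^* is the restriction of M_z^* to it; S_w f differs from wf by the projection of wf to [p]; and
  M_z^* commutes with M_w. Hence Y_p f is minus M_z^* P_[p] wf plus a vector of [p], and projecting
  to Q_p removes that vector. The same projection removes M_z^* of the term with zeta phi_{n-1},
  which is q phi_{n-1} up to a scalar and so lies in [p]. The reversed polynomial that survives has
  constant coefficient kappa_n, which is why a_q meets kappa_n^2 just as b_q does. Projections and
  adjoints are definite descriptions, usable only once a candidate is exhibited. Candidates are
  built from one vector in each degree and assembled by \<open>hardy_glue\<close>, in place of an
  appeal to completeness. Since multiplicities are finite dimensions, every s > 0 must equal beta_n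
  for finitely many n only, which requires alpha_n to tend to 0.\<close>

definition poly_inner :: "complex measure \<Rightarrow> complex poly \<Rightarrow> complex poly \<Rightarrow> complex"
  where "poly_inner M f g = (LINT \<zeta>|M. poly f \<zeta> * cnj (poly g \<zeta>))"

text \<open>The polynomial form of \<open>reversed\<close>, which is only a function off the origin.
  The degree is an argument because reversing at \<open>Suc n\<close> instead of \<open>n\<close>
  multiplies by the variable (\<open>crev_Suc\<close>).\<close>

definition crev :: "nat \<Rightarrow> complex poly \<Rightarrow> complex poly"
  where "crev n f = (\<Sum>i\<le>n. monom (cnj (coeff f (n - i))) i)"

text \<open>Used in place of \<open>degree f < n\<close>, which no polynomial satisfies for n = 0;
  in this form n = 0 leaves exactly f = 0.\<close>

abbreviation deg_below :: "complex poly \<Rightarrow> nat \<Rightarrow> bool"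
  where "deg_below f n \<equiv> \<forall>i\<ge>n. coeff f i = 0"

lemma deg_below_Suc_iff: "deg_below f (Suc n) \<longleftrightarrow> degree f \<le> n"
  by (auto intro: degree_le coeff_eq_0)

lemma coeff_crev: "coeff (crev n f) i = (if i \<le> n then cnj (coeff f (n - i)) else 0)"
  by (simp add: crev_def coeff_sum)

lemma degree_crev: "degree (crev n f) \<le> n"
  by (rule degree_le) (simp add: coeff_crev)

lemma crev_crev: "degree f \<le> n \<Longrightarrow> crev n (crev n f) = f"
  by (rule poly_eqI) (auto simp: coeff_crev coeff_eq_0)

lemma crev_diff: "crev n (f - g) = crev n f - crev n g"
  and crev_smult: "crev n (smult c f) = smult (cnj c) (crev n f)"
  and crev_Suc_pCons: "crev (Suc n) (pCons 0 f) = crev n f"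
  by (rule poly_eqI; auto simp: coeff_crev coeff_pCons Suc_diff_le split: nat.splits)+

lemma crev_Suc: "degree f \<le> n \<Longrightarrow> crev (Suc n) f = pCons 0 (crev n f)"
  by (rule poly_eqI) (auto simp: coeff_crev coeff_pCons coeff_eq_0 split: nat.splits)

lemma poly_eq_sum_le:
  fixes x :: "'a::comm_semiring_1"
  shows "degree f \<le> n \<Longrightarrow> poly f x = (\<Sum>i\<le>n. coeff f i * x ^ i)"
  unfolding poly_altdef by (rule sum.mono_neutral_left) (auto simp: coeff_eq_0)

lemma poly_crev:
  assumes f: "degree f \<le> n" and \<zeta>: "\<zeta> \<noteq> 0"
  shows "poly (crev n f) \<zeta> = reversed n f \<zeta>"
proof -
  define y where "y = 1 / \<zeta>"
  have y: "\<zeta> * y = 1" using \<zeta> by (simp add: y_def)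
  have "reversed n f \<zeta> = \<zeta> ^ n * (\<Sum>i\<le>n. cnj (coeff f i) * y ^ i)"
    by (simp add: reversed_def poly_eq_sum_le[OF f] y_def)
  also have "(\<Sum>i\<le>n. cnj (coeff f i) * y ^ i) = (\<Sum>i\<le>n. cnj (coeff f (n - i)) * y ^ (n - i))"
    using sum.atLeastAtMost_rev[of "\<lambda>i. cnj (coeff f i) * y ^ i" 0 n] by (simp add: atLeast0AtMost)
  also have "\<zeta> ^ n * \<dots> = (\<Sum>i\<le>n. cnj (coeff f (n - i)) * \<zeta> ^ i)"
    unfolding sum_distrib_left
  proof (rule sum.cong[OF refl])
    fix i assume "i \<in> {..n}"
    then have "\<zeta> ^ n = \<zeta> ^ i * \<zeta> ^ (n - i)" by (simp flip: power_add)
    then have "\<zeta> ^ n * y ^ (n - i) = \<zeta> ^ i * (\<zeta> * y) ^ (n - i)"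
      by (simp only: power_mult_distrib mult.assoc)
    then show "\<zeta> ^ n * (cnj (coeff f (n - i)) * y ^ (n - i)) = cnj (coeff f (n - i)) * \<zeta> ^ i"
      unfolding y by (simp add: mult.left_commute)
  qed
  also have "\<dots> = poly (crev n f) \<zeta>"
    unfolding poly_eq_sum_le[OF degree_crev] by (rule sum.cong) (simp_all add: coeff_crev)
  finally show ?thesis by simp
qed

lemma poly_crev_circle:
  assumes "degree f \<le> n" "cmod \<zeta> = 1"
  shows "poly (crev n f) \<zeta> = \<zeta> ^ n * cnj (poly f \<zeta>)"
proof -
  have "\<zeta> * cnj \<zeta> = 1" using assms(2) by (simp add: complex_norm_square[symmetric])
  then have "1 / cnj \<zeta> = \<zeta>" by (auto simp: divide_simps)
  moreover have "\<zeta> \<noteq> 0" using assms(2) by auto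
  ultimately show ?thesis using poly_crev[OF assms(1)] by (simp add: reversed_def)
qed

section \<open>The inner product of polynomials for a probability measure on the circle\<close>

lemma poly_bounded_on_circle: "\<exists>B. \<forall>z. cmod z = 1 \<longrightarrow> cmod (poly f z) \<le> B"
proof -
  have "compact (poly f ` sphere 0 1)"
    by (intro compact_continuous_image continuous_intros) simp
  from compact_imp_bounded[OF this] show ?thesis
    unfolding bounded_iff by (metis dist_0_norm image_eqI mem_sphere)
qed

lemma borel_measurable_poly [measurable]: "(\<lambda>z. poly f z :: complex) \<in> borel_measurable borel"
  by (intro borel_measurable_continuous_onI continuous_intros)

lemma borel_measurable_poly_inner [measurable]:
  "(\<lambda>z. poly f z * cnj (poly g z)) \<in> borel_measurable borel"
  by (intro borel_measurable_continuous_onI continuous_intros)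

text \<open>Definiteness is postponed to \<open>circle_prob\<close>: for Haar measure it is deduced
  from the coefficient formula \<open>poly_inner_haar\<close>, whose proof already uses the rules of
  this locale.\<close>

locale circle_space = prob_space M for M :: "complex measure" +
  assumes sets_M [measurable_cong]: "sets M = sets borel"
    and on_circle: "AE z in M. cmod z = 1"
begin

lemma poly_inner_integrable: "integrable M (\<lambda>z. poly f z * cnj (poly g z))"
proof -
  obtain B where "\<forall>z. cmod z = 1 \<longrightarrow> cmod (poly f z) \<le> B"
    using poly_bounded_on_circle by blast
  moreover obtain C where "\<forall>z. cmod z = 1 \<longrightarrow> cmod (poly g z) \<le> C"
    using poly_bounded_on_circle by blast
  ultimately have *: "cmod (poly f z * cnj (poly g z)) \<le> B * C" if "cmod z = 1" for z
    unfolding norm_mult complex_mod_cnj using that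
    by (meson mult_mono norm_ge_zero order_trans)
  show ?thesis
    by (rule integrable_const_bound[where B = "B * C"]) (use on_circle * in \<open>auto elim: eventually_mono simp: measurable_cong_sets[OF sets_M refl]\<close>)
qed

lemma poly_inner_add_left: "poly_inner M (f + g) h = poly_inner M f h + poly_inner M g h"
  and poly_inner_diff_left: "poly_inner M (f - g) h = poly_inner M f h - poly_inner M g h"
  and poly_inner_smult_left: "poly_inner M (smult c f) h = c * poly_inner M f h"
  and poly_inner_zero_left: "poly_inner M 0 h = 0"
  unfolding poly_inner_def by (simp_all add: distrib_right left_diff_distrib poly_inner_integrable mult.assoc)

lemma poly_inner_cnj: "cnj (poly_inner M f g) = poly_inner M g f"
  unfolding poly_inner_def by (subst Bochner_Integration.integral_cnj[symmetric]) (simp add: mult.commute)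

lemma poly_inner_add_right: "poly_inner M h (f + g) = poly_inner M h f + poly_inner M h g"
  and poly_inner_diff_right: "poly_inner M h (f - g) = poly_inner M h f - poly_inner M h g"
  and poly_inner_smult_right: "poly_inner M h (smult c f) = cnj c * poly_inner M h f"
  and poly_inner_zero_right: "poly_inner M h 0 = 0"
  using arg_cong[OF poly_inner_add_left[of f g h], of cnj] arg_cong[OF poly_inner_diff_left[of f g h], of cnj]
    arg_cong[OF poly_inner_smult_left[of c f h], of cnj] arg_cong[OF poly_inner_zero_left[of h], of cnj]
  by (simp_all only: poly_inner_cnj complex_cnj_add complex_cnj_diff complex_cnj_mult complex_cnj_zero)

lemmas poly_inner_simps = poly_inner_add_left poly_inner_diff_left poly_inner_smult_left poly_inner_zero_left
  poly_inner_add_right poly_inner_diff_right poly_inner_smult_right poly_inner_zero_right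

lemma poly_inner_pCons: "poly_inner M (pCons 0 f) (pCons 0 g) = poly_inner M f g"
  unfolding poly_inner_def
proof (rule integral_cong_AE)
  have "poly (pCons 0 f) z * cnj (poly (pCons 0 g) z) = poly f z * cnj (poly g z)" if "cmod z = 1" for z
  proof -
    have "z * cnj z = 1" using that by (simp add: complex_norm_square[symmetric])
    then have "(z * cnj z) * (poly f z * cnj (poly g z)) = poly f z * cnj (poly g z)" by simp
    then show ?thesis by (simp only: poly_pCons complex_cnj_add complex_cnj_mult ac_simps) simp
  qed
  with on_circle show "AE z in M. poly (pCons 0 f) z * cnj (poly (pCons 0 g) z) = poly f z * cnj (poly g z)"
    by (auto elim: eventually_mono)
qed (simp_all add: measurable_cong_sets[OF sets_M refl] borel_measurable_poly_inner del: poly_pCons)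

text \<open>On the circle both integrands equal
  \<open>\<zeta> ^ n * cnj (poly f \<zeta> * poly g \<zeta>)\<close>, which is symmetric in
  \<open>f\<close> and \<open>g\<close>.\<close>

lemma poly_inner_crev:
  assumes "degree f \<le> n" "degree g \<le> n"
  shows "poly_inner M (crev n f) g = poly_inner M (crev n g) f"
  unfolding poly_inner_def
proof (rule integral_cong_AE)
  show "AE z in M. poly (crev n f) z * cnj (poly g z) = poly (crev n g) z * cnj (poly f z)"
    using on_circle by eventually_elim (simp add: poly_crev_circle assms)
qed (simp_all add: measurable_cong_sets[OF sets_M refl] borel_measurable_poly_inner del: poly_pCons)

lemma poly_inner_self: "poly_inner M f f = of_real (Re (poly_inner M f f))" and poly_inner_self_nonneg: "0 \<le> Re (poly_inner M f f)"
proof -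
  have "poly_inner M f f = of_real (LINT z|M. (cmod (poly f z))\<^sup>2)"
    unfolding poly_inner_def by (subst integral_complex_of_real[symmetric]) (simp only: complex_norm_square)
  moreover have "0 \<le> (LINT z|M. (cmod (poly f z))\<^sup>2)" by simp
  ultimately show "poly_inner M f f = of_real (Re (poly_inner M f f))" "0 \<le> Re (poly_inner M f f)" by simp_all
qed

end

text \<open>
  The number $\overline{\alpha_n}$ is forced by the Szego recursion: pairing it with $\varphi_n^*$, which is
  orthogonal to $\varphi_{n+1}$, gives $\overline{\alpha_n} = \langle\zeta\varphi_n, \varphi_n^*\rangle$.
\<close>

definition schur_step :: "complex measure \<Rightarrow> nat \<Rightarrow> complex poly \<Rightarrow> complex"
  where "schur_step M n f = poly_inner M (pCons 0 f) (crev n f)"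

text \<open>The recursion serves as the definition, so that existence of the orthonormal polynomials
  follows by induction from \<open>szego_step\<close>.\<close>

primrec szego :: "complex measure \<Rightarrow> nat \<Rightarrow> complex poly" where
  "szego M 0 = 1"
| "szego M (Suc n) = smult (of_real (1 / sqrt (1 - (cmod (schur_step M n (szego M n)))\<^sup>2)))
     (pCons 0 (szego M n) - smult (schur_step M n (szego M n)) (crev n (szego M n)))"

declare szego.simps(2) [simp del]

definition szego_alpha :: "complex measure \<Rightarrow> nat \<Rightarrow> complex"
  where "szego_alpha M n = cnj (schur_step M n (szego M n))"

definition szego_rho :: "complex measure \<Rightarrow> nat \<Rightarrow> real"
  where "szego_rho M n = sqrt (1 - (cmod (szego_alpha M n))\<^sup>2)"

text \<open>Characterizes phi_n without reference to the other members of the sequence, so existence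
  and uniqueness can be treated index by index.\<close>

definition is_szego :: "complex measure \<Rightarrow> nat \<Rightarrow> complex poly \<Rightarrow> bool"
  where "is_szego M n f \<longleftrightarrow> degree f \<le> n \<and> (\<exists>\<kappa>>0. coeff f n = complex_of_real \<kappa>) \<and>
    poly_inner M f f = 1 \<and> (\<forall>g. deg_below g n \<longrightarrow> poly_inner M f g = 0)"

text \<open>Definiteness is what makes |alpha_n| < 1: equality would produce a non-zero polynomial
  of norm 0.\<close>

locale circle_prob = circle_space +
  assumes poly_inner_eq_0: "poly_inner M f f = 0 \<Longrightarrow> f = 0"
begin

text \<open>On polynomials of degree at most \<open>n\<close> the map \<open>crev n\<close>
  preserves inner products up to conjugation, and it takes multiples of the variable to polynomials
  of degree below \<open>n\<close>, to which \<open>f\<close> is orthogonal.\<close>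

lemma crev_orth:
  assumes "is_szego M n f" "deg_below h n"
  shows "poly_inner M (crev n f) (pCons 0 h) = 0"
proof -
  have h: "degree (pCons 0 h) \<le> n"
    using assms(2) by (intro degree_le) (auto simp: coeff_pCons split: nat.splits)
  have "deg_below (crev n (pCons 0 h)) n"
    by (auto simp: coeff_crev)
  then have "poly_inner M f (crev n (pCons 0 h)) = 0"
    using assms(1) by (auto simp: is_szego_def)
  then have "poly_inner M (crev n (pCons 0 h)) f = 0"
    by (metis poly_inner_cnj complex_cnj_zero)
  then show ?thesis using poly_inner_crev[OF _ h] assms(1) by (auto simp: is_szego_def)
qed

lemma poly_inner_crev_crev: "degree f \<le> n \<Longrightarrow> poly_inner M (crev n f) (crev n f) = poly_inner M f f"
  by (subst poly_inner_crev) (auto simp: degree_crev crev_crev)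

text \<open>The constant coefficient of \<open>crev n f\<close> is the positive leading coefficient
  of \<open>f\<close>, so a multiple of \<open>crev n f\<close> can clear the constant coefficient
  of \<open>g\<close>.\<close>

lemma crev_decomp:
  assumes "is_szego M n f" "degree g \<le> n"
  obtains c h where "g = smult c (crev n f) + pCons 0 h" "deg_below h n"
proof -
  obtain \<kappa> where k: "\<kappa> > 0" "coeff f n = complex_of_real \<kappa>"
    using assms(1) by (auto simp: is_szego_def)
  define c where "c = coeff g 0 / of_real \<kappa>"
  define r where "r = g - smult c (crev n f)"
  have "coeff r 0 = 0" using k by (simp add: r_def c_def coeff_crev)
  then obtain h where h: "r = pCons 0 h" by (cases r) auto
  have "degree r \<le> n" unfolding r_def
    by (intro degree_diff_le assms(2) order.trans[OF degree_smult_le] degree_crev)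
  then have "deg_below r (Suc n)" by (simp add: deg_below_Suc_iff)
  then have "deg_below h n" unfolding h by (auto simp: coeff_pCons split: nat.splits)
  then show ?thesis using that[of c h] h by (simp add: r_def algebra_simps)
qed

lemma szego_decomp:
  assumes "is_szego M n f" "degree g \<le> n"
  obtains c h where "g = smult c f + h" "deg_below h n"
proof -
  obtain \<kappa> where k: "\<kappa> > 0" "coeff f n = complex_of_real \<kappa>" and f: "degree f \<le> n"
    using assms(1) by (auto simp: is_szego_def)
  let ?c = "coeff g n / of_real \<kappa>"
  have "coeff (g - smult ?c f) i = 0" if "i \<ge> n" for i
  proof (cases "i = n")
    case False
    then show ?thesis using that f assms(2) by (simp add: coeff_eq_0)
  qed (use k in simp)
  then have "deg_below (g - smult ?c f) n" by blast
  then show ?thesis by (rule that[rotated]) simp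
qed

text \<open>Both \<open>pCons 0 f\<close> and \<open>crev n f\<close> are orthogonal to all
  \<open>pCons 0 r\<close> with \<open>r\<close> of degree below \<open>n\<close>. Subtracting from
  the former its component along the unit vector \<open>crev n f\<close> gives a vector orthogonal
  to all polynomials of degree at most \<open>n\<close>, of squared norm 1 - |c|^2 by
  Pythagoras.\<close>

lemma szego_step:
  assumes f: "is_szego M n f"
  defines "c \<equiv> schur_step M n f"
  shows "cmod c < 1" "is_szego M (Suc n) (smult (of_real (1 / sqrt (1 - (cmod c)\<^sup>2)))
     (pCons 0 f - smult c (crev n f)))" (is "is_szego M _ (smult _ ?g)")
proof -
  obtain \<kappa> where k: "\<kappa> > 0" "coeff f n = complex_of_real \<kappa>" and d: "degree f \<le> n"
    and n: "poly_inner M f f = 1" using f by (auto simp: is_szego_def)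
  have B: "poly_inner M (crev n f) (crev n f) = 1" by (simp add: poly_inner_crev_crev d n)
  have c: "poly_inner M (pCons 0 f) (crev n f) = c" "poly_inner M (crev n f) (pCons 0 f) = cnj c"
    by (auto simp: c_def schur_step_def poly_inner_cnj)
  have gg: "poly_inner M ?g ?g = of_real (1 - (cmod c)\<^sup>2)"
    unfolding of_real_diff complex_norm_square by (simp add: poly_inner_simps poly_inner_pCons n B c)
  \<comment> \<open>\<open>crev n f\<close> has no coefficient of index \<open>Suc n\<close>, so the
    leading coefficient of \<open>f\<close> survives. This excludes \<open>?g = 0\<close>, and with
    it |c| = 1.\<close>
  have g_top: "coeff ?g (Suc n) = of_real \<kappa>" by (simp add: k coeff_crev)
  have "?g \<noteq> 0" using g_top k by (metis coeff_0 of_real_eq_0_iff less_irrefl)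
  then have "1 - (cmod c)\<^sup>2 \<noteq> 0" using gg poly_inner_eq_0[of ?g] by (metis of_real_0)
  moreover have "0 \<le> 1 - (cmod c)\<^sup>2" using gg poly_inner_self_nonneg[of ?g] by simp
  ultimately have pos: "0 < 1 - (cmod c)\<^sup>2" by simp
  then show "cmod c < 1" by (simp add: power_less_one_iff)
  define s where "s = 1 / sqrt (1 - (cmod c)\<^sup>2)"
  have s: "s > 0" "s * s * (1 - (cmod c)\<^sup>2) = 1"
    using pos real_sqrt_pow2[of "1 - (cmod c)\<^sup>2"] by (simp_all add: s_def power2_eq_square)
  have orth: "poly_inner M ?g h = 0" if "deg_below h (Suc n)" for h
  proof -
    have "degree h \<le> n" using that by (simp add: deg_below_Suc_iff)
    then obtain a r where h: "h = smult a (crev n f) + pCons 0 r" "deg_below r n"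
      by (rule crev_decomp[OF f])
    have "poly_inner M f r = 0" using f h by (auto simp: is_szego_def)
    then show ?thesis
      by (simp add: h(1) poly_inner_simps poly_inner_pCons c B crev_orth[OF f h(2)])
  qed
  have "degree ?g \<le> Suc n"
    using d degree_pCons_le[of 0 f] degree_smult_le[of c "crev n f"] degree_crev[of n f]
    by (intro degree_diff_le) auto
  then have "degree (smult (of_real s) ?g) \<le> Suc n" by (rule order.trans[OF degree_smult_le])
  moreover have "coeff (smult (of_real s) ?g) (Suc n) = of_real (s * \<kappa>)"
    using g_top by simp
  moreover have "s * \<kappa> > 0" using s k by simp
  moreover have "poly_inner M (smult (of_real s) ?g) (smult (of_real s) ?g) = of_real (s * s * (1 - (cmod c)\<^sup>2))"
    by (simp only: poly_inner_smult_left poly_inner_smult_right gg) simp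
  moreover have "\<forall>h. deg_below h (Suc n) \<longrightarrow> poly_inner M (smult (of_real s) ?g) h = 0"
    using orth by (simp add: poly_inner_smult_left)
  ultimately show "is_szego M (Suc n) (smult (of_real (1 / sqrt (1 - (cmod c)\<^sup>2))) ?g)"
    using s(2) unfolding is_szego_def s_def[symmetric] by auto
qed

lemma is_szego_szego: "is_szego M n (szego M n)"
proof (induction n)
  case 0
  have "poly_inner M 1 1 = 1" by (simp add: poly_inner_def prob_space)
  moreover have "g = 0" if "deg_below g 0" for g :: "complex poly"
    using that by (intro poly_eqI) simp
  then have "\<forall>g. deg_below g 0 \<longrightarrow> poly_inner M 1 g = 0" by (metis poly_inner_zero_right)
  with \<open>poly_inner M 1 1 = 1\<close> show ?case by (auto simp: is_szego_def intro!: exI[of _ 1])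
next
  case (Suc n)
  then show ?case using szego_step(2) by (simp add: szego.simps(2))
qed

lemma szego_alpha_less_1: "cmod (szego_alpha M n) < 1"
  using szego_step(1)[OF is_szego_szego] by (simp add: szego_alpha_def)

lemma szego_rho_pos: "szego_rho M n > 0"
  using szego_alpha_less_1[of n] by (simp add: szego_rho_def power_less_one_iff)

lemma szego_rho_square: "(szego_rho M n)\<^sup>2 = 1 - (cmod (szego_alpha M n))\<^sup>2"
  using szego_alpha_less_1[of n] by (simp add: szego_rho_def power_le_one)

lemma szego_recursion:
  "smult (of_real (szego_rho M n)) (szego M (Suc n)) =
     pCons 0 (szego M n) - smult (cnj (szego_alpha M n)) (crev n (szego M n))"
proof -
  have "complex_of_real (szego_rho M n) \<noteq> 0" using szego_rho_pos[of n] by simp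
  then show ?thesis by (simp add: szego.simps(2) szego_rho_def szego_alpha_def)
qed

lemma degree_szego: "degree (szego M n) = n"
  using is_szego_szego[of n] by (auto simp: is_szego_def intro!: antisym le_degree)

text \<open>Reversing the recursion in degree \<open>Suc n\<close> gives rho phi_{n+1}^* = phi_n^* -
  alpha zeta phi_n. Eliminating phi_n^* between the two forms, with rho^2 = 1 - |alpha|^2, leaves
  this identity multiplied by rho; the factor is cancelled at the end.\<close>

lemma szego_inverse_recursion:
  "szego M (Suc n) = smult (of_real (szego_rho M n)) (pCons 0 (szego M n)) -
     smult (cnj (szego_alpha M n)) (crev (Suc n) (szego M (Suc n)))"
proof -
  let ?r = "complex_of_real (szego_rho M n)" and ?a = "szego_alpha M n"
  let ?A = "pCons 0 (szego M n)" and ?B = "crev n (szego M n)"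
  have r: "?r \<noteq> 0" using szego_rho_pos[of n] by simp
  have rr: "?r * ?r = 1 - ?a * cnj ?a"
    using szego_rho_square[of n] by (metis complex_norm_square of_real_1 of_real_diff of_real_mult power2_eq_square)
  have "smult ?r (crev (Suc n) (szego M (Suc n))) = crev (Suc n) (smult ?r (szego M (Suc n)))"
    by (simp add: crev_smult)
  also have "\<dots> = ?B - smult ?a ?A"
    by (simp only: szego_recursion crev_diff crev_smult crev_Suc_pCons)
       (simp add: crev_Suc degree_crev crev_crev degree_szego)
  finally have B: "smult ?r (crev (Suc n) (szego M (Suc n))) = ?B - smult ?a ?A" .
  have "smult ?r (smult ?r ?A - smult (cnj ?a) (crev (Suc n) (szego M (Suc n)))) =
      smult (?r * ?r) ?A - smult (cnj ?a) (smult ?r (crev (Suc n) (szego M (Suc n))))"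
    by (simp only: smult_diff_right smult_smult mult.commute[of ?r "cnj ?a"])
  also have "\<dots> = smult (?r * ?r) ?A - smult (cnj ?a) (?B - smult ?a ?A)"
    unfolding B ..
  also have "\<dots> = ?A - smult (cnj ?a) ?B"
    unfolding rr by (simp add: smult_diff_right smult_diff_left mult.commute)
  also have "\<dots> = smult ?r (szego M (Suc n))" by (rule szego_recursion[symmetric])
  finally have "smult (1 / ?r) (smult ?r (smult ?r ?A - smult (cnj ?a) (crev (Suc n) (szego M (Suc n))))) =
      smult (1 / ?r) (smult ?r (szego M (Suc n)))" by simp
  then show ?thesis using r by (simp del: smult_diff_right)
qed

definition szego_kappa :: "nat \<Rightarrow> real"
  where "szego_kappa n = Re (coeff (szego M n) n)"

lemma szego_kappa_pos: "szego_kappa n > 0"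
  and coeff_szego: "coeff (szego M n) n = of_real (szego_kappa n)"
  using is_szego_szego[of n] by (auto simp: is_szego_def szego_kappa_def)

lemma szego_kappa_Suc: "szego_rho M n * szego_kappa (Suc n) = szego_kappa n"
proof -
  have "complex_of_real (szego_rho M n * szego_kappa (Suc n)) = of_real (szego_kappa n)"
    using arg_cong[OF szego_recursion, of "\<lambda>f. coeff f (Suc n)" n]
    by (simp add: coeff_szego coeff_crev)
  then show ?thesis using of_real_eq_iff by blast
qed

section \<open>Agreement with the orthonormal polynomials and Verblunsky coefficients of the
  statement\<close>

lemma is_orthonormal_szego: "is_orthonormal_polys M (szego M)"
proof -
  have *: "poly_inner M (szego M m) (szego M n) = 0" if "n < m" for m n
    using is_szego_szego[of m] that by (auto simp: is_szego_def degree_szego coeff_eq_0)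
  have "poly_inner M (szego M m) (szego M n) = (if m = n then 1 else 0)" for m n
    using *[of n m] *[of m n] is_szego_szego[of m] poly_inner_cnj[of "szego M n" "szego M m"]
    by (cases m n rule: linorder_cases) (auto simp: is_szego_def)
  then show ?thesis
    using szego_kappa_pos by (auto simp: is_orthonormal_polys_def degree_szego poly_inner_def coeff_szego)
qed

text \<open>The polynomials phi_0, ..., phi_{m-1} span everything of degree below m: each step of
  the induction subtracts the multiple of phi_m that clears the coefficient of index m.\<close>

lemma is_orthonormal_imp_is_szego:
  assumes "is_orthonormal_polys M \<phi>"
  shows "is_szego M n (\<phi> n)"
proof -
  from assms have d: "degree (\<phi> n) = n" and k: "\<exists>\<kappa>>0. coeff (\<phi> n) n = complex_of_real \<kappa>"
    and o: "poly_inner M (\<phi> m) (\<phi> n) = (if m = n then 1 else 0)" for m n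
    by (auto simp: is_orthonormal_polys_def poly_inner_def) metis
  have "poly_inner M (\<phi> n) g = 0" if "deg_below g m" "m \<le> n" for m g
    using that
  proof (induction m arbitrary: g)
    case 0
    then have "g = 0" by (intro poly_eqI) simp
    then show ?case by (simp add: poly_inner_simps)
  next
    case (Suc m)
    let ?h = "g - smult (coeff g m / coeff (\<phi> m) m) (\<phi> m)"
    have "coeff (\<phi> m) m \<noteq> 0" using k[of m] by auto
    then have "coeff ?h i = 0" if "i \<ge> m" for i
      using that Suc.prems d[of m] by (cases "i = m") (auto simp: coeff_eq_0)
    then have "deg_below ?h m" by blast
    moreover have "m \<le> n" using Suc.prems by simp
    ultimately have "poly_inner M (\<phi> n) ?h = 0" by (rule Suc.IH)
    moreover have "poly_inner M (\<phi> n) (\<phi> m) = 0" using o[of n m] Suc.prems by auto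
    ultimately show ?case by (simp add: poly_inner_simps)
  qed
  then show ?thesis using d k o by (auto simp: is_szego_def)
qed

text \<open>Weighting \<open>f\<close> and \<open>g\<close> by each other's leading coefficients
  makes their difference lose the coefficient of index \<open>n\<close>. Then both are orthogonal to
  the difference, so it is orthogonal to itself and vanishes; normalization makes the weights
  equal.\<close>

lemma is_szego_unique:
  assumes "is_szego M n f" "is_szego M n g"
  shows "f = g"
proof -
  obtain k where k: "k > 0" "coeff f n = complex_of_real k" and f: "degree f \<le> n" "poly_inner M f f = 1"
    using assms(1) by (auto simp: is_szego_def)
  obtain l where l: "l > 0" "coeff g n = complex_of_real l" and g: "degree g \<le> n" "poly_inner M g g = 1"
    using assms(2) by (auto simp: is_szego_def)
  let ?h = "smult (of_real l) f - smult (of_real k) g"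
  have h: "deg_below ?h n"
  proof (intro allI impI)
    fix i assume "n \<le> i"
    then show "coeff ?h i = 0"
      using k l f g by (cases "i = n") (auto simp: coeff_eq_0)
  qed
  have "poly_inner M f ?h = 0" "poly_inner M g ?h = 0" using assms h by (auto simp: is_szego_def)
  then have "poly_inner M ?h ?h = 0" by (simp add: poly_inner_diff_left poly_inner_smult_left)
  then have "?h = 0" by (rule poly_inner_eq_0)
  then have *: "smult (of_real l) f = smult (of_real k) g" by simp
  have "of_real (l * l) * poly_inner M f f = of_real (k * k) * poly_inner M g g"
    using arg_cong[OF *, of "\<lambda>x. poly_inner M x x"] by (simp add: poly_inner_simps mult.assoc)
  then have "l * l = k * k" using f g by (simp flip: of_real_mult)
  then have "l = k" using k l by (simp flip: power2_eq_square)
  then have "smult (1 / of_real k) (smult (of_real k) f) = smult (1 / of_real k) (smult (of_real k) g)"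
    using * by simp
  then show ?thesis using k by simp
qed

lemma orthonormal_polys_eq: "orthonormal_polys M = szego M"
  unfolding orthonormal_polys_def
proof (rule the_equality)
  show "\<phi> = szego M" if "is_orthonormal_polys M \<phi>" for \<phi>
    using is_orthonormal_imp_is_szego[OF that] is_szego_szego is_szego_unique by blast
qed (rule is_orthonormal_szego)

lemma kappa_eq: "kappa M n = szego_kappa n"
  by (simp add: kappa_def orthonormal_polys_eq degree_szego szego_kappa_def)

text \<open>For uniqueness, top coefficients first force the square root to be rho_n, whatever the
  phase of the number. The left side of the recursion is then known, and comparing constant
  coefficients on the right identifies the number itself.\<close>

lemma verblunsky_eq: "verblunsky M n = szego_alpha M n"
  unfolding verblunsky_def orthonormal_polys_eq
proof (rule the_equality)
  show "cmod (szego_alpha M n) < 1 \<and>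
    (\<forall>\<zeta>. \<zeta> \<noteq> 0 \<longrightarrow> of_real (sqrt (1 - (cmod (szego_alpha M n))\<^sup>2)) * poly (szego M (Suc n)) \<zeta> =
       \<zeta> * poly (szego M n) \<zeta> - cnj (szego_alpha M n) * reversed n (szego M n) \<zeta>)"
  proof (intro conjI allI impI szego_alpha_less_1)
    fix \<zeta> :: complex assume "\<zeta> \<noteq> 0"
    with arg_cong[OF szego_recursion, of "\<lambda>f. poly f \<zeta>" n]
    show "of_real (sqrt (1 - (cmod (szego_alpha M n))\<^sup>2)) * poly (szego M (Suc n)) \<zeta> =
       \<zeta> * poly (szego M n) \<zeta> - cnj (szego_alpha M n) * reversed n (szego M n) \<zeta>"
      by (simp add: szego_rho_def poly_crev degree_szego)
  qed
next
  fix \<alpha>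
  assume a: "cmod \<alpha> < 1 \<and> (\<forall>\<zeta>. \<zeta> \<noteq> 0 \<longrightarrow>
      of_real (sqrt (1 - (cmod \<alpha>)\<^sup>2)) * poly (szego M (Suc n)) \<zeta> =
        \<zeta> * poly (szego M n) \<zeta> - cnj \<alpha> * reversed n (szego M n) \<zeta>)"
  let ?r = "sqrt (1 - (cmod \<alpha>)\<^sup>2)"
  let ?l = "smult (of_real ?r) (szego M (Suc n))"
    and ?g = "pCons 0 (szego M n) - smult (cnj \<alpha>) (crev n (szego M n))"
  \<comment> \<open>The recursion is assumed off the origin only; the extra factor \<zeta> extends
    it to 0, as an identity of polynomials requires.\<close>
  have "poly (pCons 0 ?l) \<zeta> = poly (pCons 0 ?g) \<zeta>" for \<zeta>
    using a by (cases "\<zeta> = 0") (simp_all add: poly_crev degree_szego)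
  then have "pCons 0 ?l = pCons 0 ?g" by (auto intro: poly_ext simp del: pCons_eq_iff)
  then have eq: "?l = ?g" by simp
  have "complex_of_real (?r * szego_kappa (Suc n)) = of_real (szego_kappa n)"
    using arg_cong[OF eq, of "\<lambda>f. coeff f (Suc n)"] by (simp add: coeff_szego coeff_crev)
  then have "?r * szego_kappa (Suc n) = szego_rho M n * szego_kappa (Suc n)"
    unfolding szego_kappa_Suc using of_real_eq_iff by blast
  then have r: "?r = szego_rho M n" using szego_kappa_pos[of "Suc n"] by simp
  have "?g = pCons 0 (szego M n) - smult (cnj (szego_alpha M n)) (crev n (szego M n))"
    using eq szego_recursion[of n] unfolding r by simp
  then have "coeff (smult (cnj \<alpha>) (crev n (szego M n))) 0 = coeff (smult (cnj (szego_alpha M n)) (crev n (szego M n))) 0"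
    by simp
  then show "\<alpha> = szego_alpha M n"
    using szego_kappa_pos[of n] by (simp add: coeff_crev coeff_szego)
qed

end

section \<open>Weighted Haar measure on the circle\<close>

lemma haar_circle_density:
  "uniform_measure lborel {0..<2 * pi} = density lborel (\<lambda>x. ennreal (indicator {0..<2 * pi} x / (2 * pi)))"
proof -
  have "indicator {0..<2 * pi} x / emeasure lborel {0..<2 * pi} = ennreal (indicator {0..<2 * pi} x / (2 * pi))" for x :: real
    by (auto simp: indicator_def divide_ennreal[symmetric] ennreal_mult' simp flip: ennreal_1)
  then show ?thesis by (simp add: uniform_measure_def)
qed

lemma cis_measurable [measurable]: "cis \<in> borel_measurable borel"
  by (intro borel_measurable_continuous_onI continuous_on_cis continuous_intros)

lemma integral_haar_circle:
  fixes f :: "complex \<Rightarrow> complex"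
  assumes [measurable]: "f \<in> borel_measurable borel"
  shows "(LINT \<zeta>|haar_circle. f \<zeta>) = (LBINT x:{0..<2 * pi}. f (cis x)) / of_real (2 * pi)"
proof -
  have "(LINT \<zeta>|haar_circle. f \<zeta>) = (LINT x|uniform_measure lborel {0..<2 * pi}. f (cis x))"
    unfolding haar_circle_def by (rule integral_distr) simp_all
  also have "\<dots> = (LBINT x. (indicator {0..<2 * pi} x / (2 * pi)) *\<^sub>R f (cis x))"
    unfolding haar_circle_density by (rule integral_density) auto
  also have "\<dots> = (LBINT x. (indicator {0..<2 * pi} x *\<^sub>R f (cis x)) / of_real (2 * pi))"
    by (intro Bochner_Integration.integral_cong) (auto simp: scaleR_conv_of_real)
  finally show ?thesis by (simp add: set_lebesgue_integral_def)
qed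

lemma circle_space_haar: "circle_space haar_circle"
proof -
  have e: "emeasure lborel {0..<2 * pi} = ennreal (2 * pi)" by simp
  have p: "prob_space (uniform_measure lborel {0..<2 * pi})"
    by (rule prob_space_uniform_measure) (simp_all add: e)
  have "prob_space haar_circle"
    unfolding haar_circle_def by (rule prob_space.prob_space_distr[OF p]) simp
  moreover have "AE z in haar_circle. cmod z = 1"
    unfolding haar_circle_def by (subst AE_distr_iff) auto
  ultimately show ?thesis
    by (intro circle_space.intro circle_space_axioms.intro) (simp_all add: haar_circle_def)
qed

interpretation haar: circle_space haar_circle by (rule circle_space_haar)

section \<open>Parseval's identity for polynomials on the circle\<close>

lemma integral_haar_power: "(LINT \<zeta>|haar_circle. \<zeta> ^ Suc n) = 0"
proof -
  define c where "c = \<i> * of_nat (Suc n)"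
  have c: "c \<noteq> 0" "cis (real (Suc n) * x) = exp (c * of_real x)" for x
    by (simp_all add: c_def cis_conv_exp mult.assoc del: of_nat_Suc)
  have F: "((\<lambda>x. cis (real (Suc n) * x) / c) has_vector_derivative cis (real (Suc n) * x)) (at x within A)"
    for x A
  proof -
    have "((\<lambda>z. exp (c * z) / c) has_field_derivative exp (c * of_real x)) (at (of_real x))"
      using c(1) by (auto intro!: derivative_eq_intros)
    then show ?thesis
      unfolding c(2) by (rule has_vector_derivative_real_field)
  qed
  have "(LBINT x:{0..<2 * pi}. cis x ^ Suc n) = (LBINT x=0..2 * pi. cis (real (Suc n) * x))"
    unfolding Complex.DeMoivre by (subst zero_ereal_def, subst interval_integral_Ico) simp_all
  also have "\<dots> = cis (real (Suc n) * (2 * pi)) / c - cis (real (Suc n) * 0) / c"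
    unfolding zero_ereal_def by (rule interval_integral_FTC_finite[OF _ F]) (intro continuous_intros)
  also have "cis (real (Suc n) * (2 * pi)) = 1"
    by (metis cis_2pi power_one Complex.DeMoivre)
  finally show ?thesis
    by (subst integral_haar_circle) simp_all
qed

lemma poly_inner_haar_pCons_1: "poly_inner haar_circle (pCons 0 f) 1 = 0"
proof -
  have i: "integrable haar_circle (\<lambda>\<zeta>. c * \<zeta> ^ i)" for c i
    using haar.poly_inner_integrable[of "monom c i" 1] by (simp add: poly_monom)
  have "poly_inner haar_circle (pCons 0 f) 1 = (LINT \<zeta>|haar_circle. (\<Sum>i\<le>degree f. coeff f i * \<zeta> ^ Suc i))"
    unfolding poly_inner_def poly_pCons poly_altdef[of f]
    by (intro Bochner_Integration.integral_cong) (simp_all add: sum_distrib_left mult_ac)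
  also have "\<dots> = (\<Sum>i\<le>degree f. LINT \<zeta>|haar_circle. coeff f i * \<zeta> ^ Suc i)"
    by (rule Bochner_Integration.integral_sum) (rule i)
  also have "\<dots> = 0"
    by (simp only: integral_mult_right_zero integral_haar_power) simp
  finally show ?thesis .
qed

text \<open>Splitting off constant terms leaves two multiples of the variable, whose common factor
  cancels on the circle. The degree of \<open>g\<close> is unrestricted because its coefficients
  above \<open>n\<close> meet zero coefficients of \<open>f\<close>; this matches the truncation in
  \<open>hom\<close>.\<close>

lemma poly_inner_haar:
  "degree f \<le> n \<Longrightarrow> poly_inner haar_circle f g = (\<Sum>i\<le>n. coeff f i * cnj (coeff g i))"
proof (induction f arbitrary: g n)
  case 0
  show ?case by (simp add: haar.poly_inner_simps)
next
  case (pCons a f)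
  obtain b h where g: "g = pCons b h" by (cases g)
  have split: "pCons c k = smult c 1 + pCons 0 k" for c and k :: "complex poly"
    by (simp add: one_pCons)
  have "poly_inner haar_circle 1 1 = 1" by (simp add: poly_inner_def haar.prob_space)
  moreover have "poly_inner haar_circle 1 (pCons 0 k) = 0" for k
    using haar.poly_inner_cnj[of "pCons 0 k" 1] by (simp add: poly_inner_haar_pCons_1)
  ultimately have eq: "poly_inner haar_circle (pCons a f) g = a * cnj b + poly_inner haar_circle f h"
    unfolding g split[of a f] split[of b h]
    by (simp only: haar.poly_inner_simps haar.poly_inner_pCons poly_inner_haar_pCons_1) simp
  show ?case
  proof (cases n)
    case 0
    with pCons have "f = 0" by (auto split: if_splits)
    then show ?thesis unfolding eq using 0 by (simp add: g haar.poly_inner_simps)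
  next
    case (Suc m)
    with pCons have "degree f \<le> m" by (auto split: if_splits)
    then have "poly_inner haar_circle f h = (\<Sum>i\<le>m. coeff f i * cnj (coeff h i))" by (rule pCons.IH)
    then show ?thesis unfolding eq Suc sum.atMost_Suc_shift by (simp add: g)
  qed
qed

lemma poly_inner_haar_self: "degree f \<le> n \<Longrightarrow> poly_inner haar_circle f f = of_real (\<Sum>i\<le>n. (cmod (coeff f i))\<^sup>2)"
  by (simp only: poly_inner_haar of_real_sum complex_norm_square)

text \<open>Serves both the definiteness of the Haar inner product and the bound on kappa_n in
  \<open>kappa_bounded\<close>.\<close>

lemma coeff_le_poly_inner_haar: "(cmod (coeff f i))\<^sup>2 \<le> Re (poly_inner haar_circle f f)"
proof (cases "i \<le> degree f")
  case True
  then show ?thesis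
    unfolding poly_inner_haar_self[OF order_refl] Re_complex_of_real
    by (intro member_le_sum[of i "{..degree f}" "\<lambda>i. (cmod (coeff f i))\<^sup>2"]) auto
qed (use haar.poly_inner_self_nonneg in \<open>simp add: coeff_eq_0\<close>)

lemma circle_prob_haar: "circle_prob haar_circle"
proof (intro circle_prob.intro circle_prob_axioms.intro circle_space_haar)
  fix f :: "complex poly" assume "poly_inner haar_circle f f = 0"
  then have "(cmod (coeff f i))\<^sup>2 \<le> 0" for i using coeff_le_poly_inner_haar[of f i] by simp
  then show "f = 0" by (intro poly_eqI) simp
qed

interpretation haar: circle_prob haar_circle by (rule circle_prob_haar)

section \<open>The measure with density |q|^2 divided by its integral\<close>

lemma circle_norm_square: "(circle_norm q)\<^sup>2 = Re (poly_inner haar_circle q q)"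
proof -
  have "poly_inner haar_circle q q = of_real (LINT z|haar_circle. (cmod (poly q z))\<^sup>2)"
    unfolding poly_inner_def by (subst integral_complex_of_real[symmetric]) (simp only: complex_norm_square)
  then show ?thesis by (simp add: circle_norm_def)
qed

lemma circle_norm_pos: "q \<noteq> 0 \<Longrightarrow> circle_norm q > 0"
proof -
  assume "q \<noteq> 0"
  then have "Re (poly_inner haar_circle q q) \<noteq> 0" using haar.poly_inner_self[of q] haar.poly_inner_eq_0[of q] by auto
  then have "circle_norm q \<noteq> 0" by (auto simp flip: circle_norm_square)
  moreover have "circle_norm q \<ge> 0" by (simp add: circle_norm_def)
  ultimately show ?thesis by simp
qed

lemma integral_circle_measure:
  fixes f :: "complex \<Rightarrow> complex"
  assumes [measurable]: "f \<in> borel_measurable borel"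
  shows "(LINT \<zeta>|circle_measure q. f \<zeta>) =
    (LINT \<zeta>|haar_circle. of_real ((cmod (poly q \<zeta>))\<^sup>2) * f \<zeta>) / of_real ((circle_norm q)\<^sup>2)"
proof -
  have "(LINT \<zeta>|circle_measure q. f \<zeta>) =
      (LINT \<zeta>|haar_circle. ((cmod (poly q \<zeta>))\<^sup>2 / (circle_norm q)\<^sup>2) *\<^sub>R f \<zeta>)"
    unfolding circle_measure_def by (rule integral_density) (simp_all add: haar_circle_def)
  also have "\<dots> = (LINT \<zeta>|haar_circle. (of_real ((cmod (poly q \<zeta>))\<^sup>2) * f \<zeta>) / of_real ((circle_norm q)\<^sup>2))"
    by (simp add: scaleR_conv_of_real)
  finally show ?thesis by simp
qed

text \<open>Distributing |q|^2 as \<open>q\<close> and its conjugate over the two factors shows that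
  multiplication by q / ||q||_2 is isometric from the weighted space to that of Haar
  measure.\<close>

lemma poly_inner_circle_measure:
  "poly_inner (circle_measure q) f g = poly_inner haar_circle (q * f) (q * g) / of_real ((circle_norm q)\<^sup>2)"
  unfolding poly_inner_def integral_circle_measure[OF borel_measurable_poly_inner]
  by (simp only: complex_norm_square poly_mult complex_cnj_mult mult_ac)

lemma circle_prob_circle_measure:
  assumes "q \<noteq> 0"
  shows "circle_prob (circle_measure q)"
proof (intro circle_prob.intro circle_space.intro circle_space_axioms.intro circle_prob_axioms.intro prob_spaceI)
  let ?w = "\<lambda>\<zeta>. (cmod (poly q \<zeta>))\<^sup>2 / (circle_norm q)\<^sup>2"
  have N: "(circle_norm q)\<^sup>2 > 0" using circle_norm_pos[OF assms] by simp
  have i: "integrable haar_circle (\<lambda>\<zeta>. (cmod (poly q \<zeta>))\<^sup>2)"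
    using integrable_Re[OF haar.poly_inner_integrable[of q q]] unfolding complex_norm_square[symmetric] Re_complex_of_real .
  have "emeasure (circle_measure q) (space (circle_measure q)) = (\<integral>\<^sup>+\<zeta>. ennreal (?w \<zeta>) \<partial>haar_circle)"
    unfolding circle_measure_def by (simp add: emeasure_density haar_circle_def)
  also have "\<dots> = ennreal (LINT \<zeta>|haar_circle. ?w \<zeta>)"
    by (rule nn_integral_eq_integral) (use i in auto)
  also have "(LINT \<zeta>|haar_circle. ?w \<zeta>) = 1"
    using N by (simp add: circle_norm_def)
  finally show "emeasure (circle_measure q) (space (circle_measure q)) = 1" by simp
  show "sets (circle_measure q) = sets borel" by (simp add: circle_measure_def haar.sets_M)
  show "AE z in circle_measure q. cmod z = 1"
    unfolding circle_measure_def
    by (subst AE_density) (use haar.on_circle haar.sets_M in \<open>auto simp: haar_circle_def elim: eventually_mono\<close>)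
  fix f :: "complex poly" assume "poly_inner (circle_measure q) f f = 0"
  then have "q * f = 0" using N by (intro haar.poly_inner_eq_0) (simp add: poly_inner_circle_measure)
  then show "f = 0" using assms by simp
qed

section \<open>Homogeneous components in the Hardy space\<close>

lemma hardy_eqI: "(\<And>i j. hcoeff f (i, j) = hcoeff g (i, j)) \<Longrightarrow> f = g"
  by (metis hcoeff_inject ext surj_pair)

lemmas hcoeff_simps [simp] = zero_hardy.rep_eq plus_hardy.rep_eq uminus_hardy.rep_eq
  minus_hardy.rep_eq cscale.rep_eq mult_z.rep_eq mult_w.rep_eq hardy_of_poly.rep_eq

lemma hcoeff_summable: "(\<lambda>k. (cmod (hcoeff f k))\<^sup>2) summable_on UNIV"
  using hcoeff[of f] by simp

lemma hcoeff_sum [simp]: "hcoeff (sum f A) k = (\<Sum>a\<in>A. hcoeff (f a) k)"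
  by (induction A rule: infinite_finite_induct) simp_all

text \<open>The orthogonal projection onto \<open>H_hom d\<close>, as \<open>H_hom_iff\<close> and
  \<open>cinner_hcomp_right\<close> show.\<close>

lift_definition hcomp :: "nat \<Rightarrow> hardy \<Rightarrow> hardy" is "\<lambda>d a (i, j). if i + j = d then a (i, j) else 0"
  by (erule summable_on_comparison_test) auto

text \<open>The adjoint of multiplication by z, see \<open>cinner_mult_z\<close>; likewise
  \<open>back_w\<close> is the adjoint of \<open>mult_w\<close>.\<close>

lift_definition back_z :: "hardy \<Rightarrow> hardy" is "\<lambda>a (i, j). a (Suc i, j)"
proof -
  fix a :: "nat \<times> nat \<Rightarrow> complex"
  let ?h = "\<lambda>(i::nat, j::nat). (Suc i, j)"
  assume "(\<lambda>k. (cmod (a k))\<^sup>2) summable_on UNIV"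
  then have "(\<lambda>k. (cmod (a k))\<^sup>2) summable_on range ?h"
    by (rule summable_on_subset) simp
  then have "((\<lambda>k. (cmod (a k))\<^sup>2) \<circ> ?h) summable_on UNIV"
    by (subst (asm) summable_on_reindex) (auto simp: inj_on_def)
  then show "(\<lambda>k. (cmod (case k of (i, j) \<Rightarrow> a (Suc i, j)))\<^sup>2) summable_on UNIV"
    by (simp add: o_def case_prod_unfold)
qed

lift_definition back_w :: "hardy \<Rightarrow> hardy" is "\<lambda>a (i, j). a (i, Suc j)"
proof -
  fix a :: "nat \<times> nat \<Rightarrow> complex"
  let ?h = "\<lambda>(i::nat, j::nat). (i, Suc j)"
  assume "(\<lambda>k. (cmod (a k))\<^sup>2) summable_on UNIV"
  then have "(\<lambda>k. (cmod (a k))\<^sup>2) summable_on range ?h"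
    by (rule summable_on_subset) simp
  then have "((\<lambda>k. (cmod (a k))\<^sup>2) \<circ> ?h) summable_on UNIV"
    by (subst (asm) summable_on_reindex) (auto simp: inj_on_def)
  then show "(\<lambda>k. (cmod (case k of (i, j) \<Rightarrow> a (i, Suc j)))\<^sup>2) summable_on UNIV"
    by (simp add: o_def case_prod_unfold)
qed

text \<open>
  The homogenization $\sum_i f_i z^i w^{d-i}$; coefficients of \<open>f\<close> of index above \<open>d\<close> are dropped,
  which makes the backward shift \<open>back_w\<close> a mere change of \<open>d\<close>.
\<close>

lift_definition hom :: "nat \<Rightarrow> complex poly \<Rightarrow> hardy" is "\<lambda>d f (i, j). if i + j = d then coeff f i else 0"
proof (rule finite_nonzero_values_imp_summable_on)
  fix d :: nat and f :: "complex poly"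
  have "{k \<in> UNIV. (cmod (case k of (i, j) \<Rightarrow> if i + j = d then coeff f i else 0))\<^sup>2 \<noteq> 0} \<subseteq> {..d} \<times> {..d}"
    by (auto split: if_splits)
  then show "finite {k \<in> UNIV. (cmod (case k of (i, j) \<Rightarrow> if i + j = d then coeff f i else 0))\<^sup>2 \<noteq> 0}"
    by (rule finite_subset) simp
qed

lemmas hcoeff_ops [simp] = hcomp.rep_eq back_z.rep_eq back_w.rep_eq hom.rep_eq

lemma hcomp_add: "hcomp d (f + g) = hcomp d f + hcomp d g"
  and hcomp_diff: "hcomp d (f - g) = hcomp d f - hcomp d g"
  and hcomp_scale: "hcomp d (c *\<^sub>C f) = c *\<^sub>C hcomp d f"
  and hcomp_0: "hcomp d 0 = 0"
  and hcomp_hcomp: "hcomp d (hcomp e f) = (if d = e then hcomp d f else 0)"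
  and hcomp_hom: "hcomp d (hom e p) = (if d = e then hom d p else 0)"
  and hcomp_back_z: "hcomp d (back_z f) = back_z (hcomp (Suc d) f)"
  and hcomp_back_w: "hcomp d (back_w f) = back_w (hcomp (Suc d) f)"
  and back_z_diff: "back_z (f - g) = back_z f - back_z g"
  and back_z_scale: "back_z (c *\<^sub>C f) = c *\<^sub>C back_z f"
  and back_z_0: "back_z 0 = 0" and back_w_0: "back_w 0 = 0"
  and back_z_mult_w: "back_z (mult_w f) = mult_w (back_z f)"
  and back_w_mult_w: "back_w (mult_w f) = f"
  and back_z_mult_z: "back_z (mult_z f) = f"
  and hom_add: "hom d (p + q) = hom d p + hom d q"
  and hom_smult: "hom d (smult c p) = c *\<^sub>C hom d p"
  and mult_z_hom: "mult_z (hom d p) = hom (Suc d) (pCons 0 p)"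
  and back_z_hom: "back_z (hom (Suc d) p) = hom d (poly_shift 1 p)"
  and back_w_hom: "back_w (hom (Suc d) p) = hom d p"
  by (rule hardy_eqI; auto simp: coeff_pCons coeff_poly_shift split: nat.splits)+

lemma mult_w_hom: "degree p \<le> d \<Longrightarrow> mult_w (hom d p) = hom (Suc d) p"
  by (rule hardy_eqI) (auto simp: coeff_eq_0)

lemma hardy_eq_hcompI: "(\<And>d. hcomp d f = hcomp d g) \<Longrightarrow> f = g"
proof (rule hardy_eqI)
  fix i j
  assume "\<And>d. hcomp d f = hcomp d g"
  then have "hcoeff (hcomp (i + j) f) (i, j) = hcoeff (hcomp (i + j) g) (i, j)" by simp
  then show "hcoeff f (i, j) = hcoeff g (i, j)" by simp
qed

section \<open>The complex inner product and its decomposition by degree\<close>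

lemma cinner_add_left: "cinner (f + g) h = cinner f h + cinner g h"
  by transfer (simp add: distrib_right infsum_add sq_summable_inner)

lemma cinner_scale_left: "cinner (c *\<^sub>C f) g = c * cinner f g"
  by transfer (simp add: mult.assoc infsum_cmult_right')

lemma cinner_cnj: "cnj (cinner f g) = cinner g f"
  by transfer (subst infsum_cnj[symmetric], simp add: mult.commute)

lemma cinner_0_left: "cinner 0 f = 0"
  by transfer simp

lemma cinner_diff_left: "cinner (f - g) h = cinner f h - cinner g h"
  using cinner_add_left[of "f - g" g h] by simp

lemma cinner_add_right: "cinner h (f + g) = cinner h f + cinner h g"
  and cinner_diff_right: "cinner h (f - g) = cinner h f - cinner h g"
  and cinner_scale_right: "cinner h (c *\<^sub>C f) = cnj c * cinner h f"
  and cinner_0_right: "cinner h 0 = 0"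
  using arg_cong[OF cinner_add_left[of f g h], of cnj] arg_cong[OF cinner_diff_left[of f g h], of cnj]
    arg_cong[OF cinner_scale_left[of c f h], of cnj] arg_cong[OF cinner_0_left[of h], of cnj]
  by (simp_all only: cinner_cnj complex_cnj_add complex_cnj_diff complex_cnj_mult complex_cnj_zero)

lemmas cinner_simps = cinner_add_left cinner_diff_left cinner_scale_left cinner_0_left
  cinner_add_right cinner_diff_right cinner_scale_right cinner_0_right

lemma inner_eq_cinner: "f \<bullet> g = Re (cinner f g)"
  by transfer simp

lemma cinner_self: "cinner f f = of_real ((norm f)\<^sup>2)"
proof (rule complex_eqI)
  show "Re (cinner f f) = Re (of_real ((norm f)\<^sup>2))"
    by (simp add: inner_eq_cinner[symmetric] power2_norm_eq_inner)
  have "Im (cnj (cinner f f)) = Im (cinner f f)" by (simp only: cinner_cnj)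
  then show "Im (cinner f f) = Im (of_real ((norm f)\<^sup>2))" by simp
qed

lemma cinner_self_eq_0: "cinner f f = 0 \<longleftrightarrow> f = 0"
  unfolding cinner_self of_real_eq_0_iff by simp

lemma norm_cscale: "norm (c *\<^sub>C f) = cmod c * norm f"
proof -
  have "complex_of_real ((norm (c *\<^sub>C f))\<^sup>2) = c * cnj c * of_real ((norm f)\<^sup>2)"
    unfolding cinner_self[symmetric] by (simp add: cinner_simps)
  also have "\<dots> = of_real ((cmod c * norm f)\<^sup>2)"
    by (simp only: complex_norm_square[symmetric] power_mult_distrib of_real_mult)
  finally show ?thesis by (simp only: of_real_eq_iff) simp
qed

lemma cinner_cauchy_schwarz: "cmod (cinner f g) \<le> norm f * norm g"
proof -
  \<comment> \<open>The phase \<open>u\<close> makes the inner product real and non-negative, which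
    reduces the claim to the real inner product.\<close>
  obtain u where u: "cmod u = 1" "u * cinner f g = of_real (cmod (cinner f g))"
  proof (cases "cinner f g = 0")
    case True
    then show ?thesis by (intro that[of 1]) auto
  next
    case False
    let ?u = "cnj (cinner f g) / of_real (cmod (cinner f g))"
    have "cmod ?u = 1" using False by (simp add: norm_divide)
    moreover have "?u * cinner f g = of_real ((cmod (cinner f g))\<^sup>2) / of_real (cmod (cinner f g))"
      by (simp only: complex_norm_square times_divide_eq_left times_divide_eq_right mult.commute)
    ultimately show ?thesis using False by (intro that[of ?u]) (auto simp: power2_eq_square)
  qed
  have "cmod (cinner f g) = (u *\<^sub>C f) \<bullet> g" by (simp add: inner_eq_cinner cinner_simps u)
  also have "\<dots> \<le> norm (u *\<^sub>C f) * norm g" by (rule norm_cauchy_schwarz)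
  finally show ?thesis by (simp add: norm_cscale u)
qed

lemma cinner_hcomp: "cinner (hcomp d f) g = (\<Sum>i\<le>d. hcoeff f (i, d - i) * cnj (hcoeff g (i, d - i)))"
proof -
  let ?S = "(\<lambda>i. (i, d - i)) ` {..d}"
  have "cinner (hcomp d f) g = (\<Sum>\<^sub>\<infinity>k. hcoeff (hcomp d f) k * cnj (hcoeff g k))"
    by (simp only: cinner.rep_eq)
  also have "\<dots> = (\<Sum>\<^sub>\<infinity>k\<in>?S. hcoeff f k * cnj (hcoeff g k))"
    by (rule infsum_cong_neutral) (auto simp: image_iff)
  also have "\<dots> = (\<Sum>k\<in>?S. hcoeff f k * cnj (hcoeff g k))" by (rule infsum_finite) simp
  also have "\<dots> = (\<Sum>i\<le>d. hcoeff f (i, d - i) * cnj (hcoeff g (i, d - i)))"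
    by (subst sum.reindex) (auto simp: inj_on_def)
  finally show ?thesis .
qed

lemma cinner_hcomp_right: "cinner f (hcomp d g) = cinner (hcomp d f) g"
proof -
  have "cinner f (hcomp d g) = cnj (cinner (hcomp d g) f)" by (simp only: cinner_cnj)
  then show ?thesis by (simp add: cinner_hcomp mult.commute)
qed

lemma cinner_hcomp_both: "cinner (hcomp d f) (hcomp d g) = cinner (hcomp d f) g"
  by (simp add: cinner_hcomp_right hcomp_hcomp)

lemma cinner_hom: "cinner f (hom d p) = (\<Sum>i\<le>d. hcoeff f (i, d - i) * cnj (coeff p i))"
proof -
  have "cinner f (hom d p) = cinner (hcomp d f) (hom d p)"
    by (metis cinner_hcomp_right hcomp_hom)
  then show ?thesis by (simp add: cinner_hcomp)
qed

lemma bij_betw_degree: "bij_betw (\<lambda>(d, i). (i, d - i)) (SIGMA d:UNIV. {..d}) (UNIV :: (nat \<times> nat) set)"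
  by (rule bij_betw_byWitness[where f' = "\<lambda>(i, j). (i + j, i)"]) auto

lemma cinner_infsum: "cinner f g = (\<Sum>\<^sub>\<infinity>d. cinner (hcomp d f) g)"
proof -
  let ?t = "\<lambda>k. hcoeff f k * cnj (hcoeff g k)"
  have s: "(\<lambda>x. ?t (case x of (d, i) \<Rightarrow> (i, d - i))) summable_on (SIGMA d:UNIV. {..d})"
    unfolding summable_on_reindex_bij_betw[OF bij_betw_degree, of ?t]
    by (rule sq_summable_inner hcoeff_summable)+
  have "cinner f g = infsum (\<lambda>x. ?t (case x of (d, i) \<Rightarrow> (i, d - i))) (SIGMA d:UNIV. {..d})"
    unfolding infsum_reindex_bij_betw[OF bij_betw_degree, of ?t] by (rule cinner.rep_eq)
  also have "\<dots> = (\<Sum>\<^sub>\<infinity>d. \<Sum>\<^sub>\<infinity>i\<in>{..d}. ?t (i, d - i))"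
    using infsum_Sigma_banach[OF s] by simp
  also have "\<dots> = (\<Sum>\<^sub>\<infinity>d. cinner (hcomp d f) g)"
    by (simp add: cinner_hcomp)
  finally show ?thesis .
qed

lemma summable_norm_hcomp: "(\<lambda>d. (norm (hcomp d f))\<^sup>2) summable_on UNIV"
  and norm_hcomp: "(norm (hcomp d f))\<^sup>2 = (\<Sum>i\<le>d. (cmod (hcoeff f (i, d - i)))\<^sup>2)"
proof -
  show *: "(norm (hcomp d f))\<^sup>2 = (\<Sum>i\<le>d. (cmod (hcoeff f (i, d - i)))\<^sup>2)" for d
  proof -
    have "complex_of_real ((norm (hcomp d f))\<^sup>2) = of_real (\<Sum>i\<le>d. (cmod (hcoeff f (i, d - i)))\<^sup>2)"
      unfolding cinner_self[symmetric] cinner_hcomp_both of_real_sum complex_norm_square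
      by (rule cinner_hcomp)
    then show ?thesis by (simp only: of_real_eq_iff)
  qed
  let ?t = "\<lambda>k. (cmod (hcoeff f k))\<^sup>2"
  have s: "(\<lambda>x. ?t (case x of (d, i) \<Rightarrow> (i, d - i))) summable_on (SIGMA d:UNIV. {..d})"
    unfolding summable_on_reindex_bij_betw[OF bij_betw_degree, of ?t]
    by (rule hcoeff_summable)
  have "(\<lambda>d. \<Sum>\<^sub>\<infinity>i\<in>{..d}. ?t (i, d - i)) summable_on UNIV"
    using summable_on_SigmaD[OF s] by simp
  then show "(\<lambda>d. (norm (hcomp d f))\<^sup>2) summable_on UNIV" by (simp add: *)
qed

text \<open>Square-summability follows by comparison with the components of \<open>f\<close>. This
  is the source of all vectors with infinitely many components: the projections to [p] and the
  adjoint of \<open>Y_op\<close>.\<close>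

lemma hardy_glue:
  assumes hom: "\<And>d. hcomp d (x d) = x d" and le: "\<And>d. norm (x d) \<le> norm (hcomp d f)"
  obtains g where "\<And>d. hcomp d g = x d"
proof -
  define a where "a = (\<lambda>(i, j). hcoeff (x (i + j)) (i, j))"
  let ?t = "\<lambda>k. (cmod (a k))\<^sup>2"
  have "(\<lambda>x. ?t (case x of (d, i) \<Rightarrow> (i, d - i))) summable_on (SIGMA d:UNIV. {..d})"
  proof (rule summable_on_SigmaI)
    show "((\<lambda>i. ?t (case (d, i) of (d, i) \<Rightarrow> (i, d - i))) has_sum (norm (x d))\<^sup>2) {..d}" for d
    proof -
      have "(norm (x d))\<^sup>2 = (\<Sum>i\<le>d. ?t (case (d, i) of (d, i) \<Rightarrow> (i, d - i)))"
        using norm_hcomp[of d "x d"] by (simp add: hom a_def)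
      then show ?thesis by (metis finite_atMost has_sum_finite)
    qed
    show "(\<lambda>d. (norm (x d))\<^sup>2) summable_on UNIV"
      by (rule summable_on_comparison_test[OF summable_norm_hcomp[of f]]) (auto intro: power_mono le)
  qed simp
  then have a: "?t summable_on UNIV"
    by (subst (asm) summable_on_reindex_bij_betw[OF bij_betw_degree, of ?t])
  have "hcomp d (Abs_hardy a) = x d" for d
  proof (rule hardy_eqI)
    fix i j
    have "hcoeff (x d) (i, j) = hcoeff (hcomp d (x d)) (i, j)" by (simp add: hom)
    then show "hcoeff (hcomp d (Abs_hardy a)) (i, j) = hcoeff (x d) (i, j)"
      using a by (auto simp: Abs_hardy_inverse a_def)
  qed
  then show ?thesis by (rule that)
qed

lemma cinner_eq_hcompI: "(\<And>d. cinner (hcomp d f) (hcomp d g) = cinner (hcomp d f') (hcomp d g')) \<Longrightarrow> cinner f g = cinner f' g'"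
  by (simp add: cinner_infsum[of f g] cinner_infsum[of f' g'] cinner_hcomp_both)

lemma cinner_mult_z: "cinner (mult_z f) g = cinner f (back_z g)"
proof -
  let ?h = "\<lambda>(i::nat, j::nat). (Suc i, j)"
  have "cinner (mult_z f) g = (\<Sum>\<^sub>\<infinity>k\<in>range ?h. hcoeff (mult_z f) k * cnj (hcoeff g k))"
    unfolding cinner.rep_eq
    by (rule infsum_cong_neutral) (auto simp: image_iff gr0_conv_Suc)
  also have "\<dots> = cinner f (back_z g)"
    unfolding cinner.rep_eq
    by (subst infsum_reindex) (auto simp: inj_on_def o_def intro!: infsum_cong)
  finally show ?thesis .
qed

lemma cinner_mult_w: "cinner (mult_w f) g = cinner f (back_w g)"
proof -
  let ?h = "\<lambda>(i::nat, j::nat). (i, Suc j)"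
  have "cinner (mult_w f) g = (\<Sum>\<^sub>\<infinity>k\<in>range ?h. hcoeff (mult_w f) k * cnj (hcoeff g k))"
    unfolding cinner.rep_eq
    by (rule infsum_cong_neutral) (auto simp: image_iff gr0_conv_Suc)
  also have "\<dots> = cinner f (back_w g)"
    unfolding cinner.rep_eq
    by (subst infsum_reindex) (auto simp: inj_on_def o_def intro!: infsum_cong)
  finally show ?thesis .
qed

text \<open>The imaginary part of <f, g> is minus the real part of <if, g>, so the complex condition
  amounts to two real orthogonality conditions, each of them closed.\<close>

lemma closed_cinner: "closed {g. cinner f g = 0}"
proof -
  have "{g. cinner f g = 0} = {g. f \<bullet> g = 0} \<inter> {g. (\<i> *\<^sub>C f) \<bullet> g = 0}"
    by (auto simp: inner_eq_cinner cinner_simps complex_eq_iff)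
  also have "closed \<dots>"
    by (intro closed_Int closed_Collect_eq continuous_intros)
  finally show ?thesis .
qed

lemma closed_hperp: "closed (hperp V)"
proof -
  have "hperp V = (\<Inter>g\<in>V. {f. cinner g f = 0})"
    unfolding hperp_def by (auto, (metis cinner_cnj complex_cnj_zero)+)
  then show ?thesis by (auto intro: closed_cinner)
qed

text \<open>Allows membership in \<open>Q_mod p\<close> to be tested on polynomial multiples of
  \<open>p\<close> alone.\<close>

lemma hperp_closure: "hperp (closure S) = hperp S"
proof
  show "hperp S \<subseteq> hperp (closure S)"
  proof
    fix f assume "f \<in> hperp S"
    then have "S \<subseteq> {g. cinner f g = 0}" by (auto simp: hperp_def)
    then have "closure S \<subseteq> {g. cinner f g = 0}" by (rule closure_minimal) (rule closed_cinner)
    then show "f \<in> hperp (closure S)" by (auto simp: hperp_def)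
  qed
  show "hperp (closure S) \<subseteq> hperp S"
    using closure_subset[of S] by (auto simp: hperp_def)
qed

lemma csubspace_hperp: "csubspace (hperp V)"
  by (auto simp: hardy.subspace_def hperp_def cinner_simps)

lemma hperp_self: "f \<in> V \<Longrightarrow> f \<in> hperp V \<Longrightarrow> f = 0"
  unfolding hperp_def using cinner_self_eq_0 by blast

lemma hproj_eqI:
  assumes M: "csubspace M" and g: "g \<in> M" "f - g \<in> hperp M"
  shows "hproj M f = g"
  unfolding hproj_def
proof (rule the_equality)
  fix h assume h: "h \<in> M \<and> f - h \<in> hperp M"
  have "h - g \<in> M" using M h g by (blast intro: hardy.subspace_diff)
  moreover have "(f - g) - (f - h) \<in> hperp M" using h g csubspace_hperp by (blast intro: hardy.subspace_diff)
  ultimately show "h = g" using hperp_self[of "h - g" M] by simp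
qed (use g in simp)

lemma adj_on_eqI:
  assumes M: "csubspace M" and g: "g \<in> M" "\<And>u. u \<in> M \<Longrightarrow> cinner (T u) f = cinner u g"
  shows "adj_on M T f = g"
  unfolding adj_on_def
proof (rule the_equality)
  fix h assume h: "h \<in> M \<and> (\<forall>u\<in>M. cinner (T u) f = cinner u h)"
  have d: "h - g \<in> M" using M h g by (blast intro: hardy.subspace_diff)
  then have "cinner (h - g) (h - g) = 0" using h g by (simp add: cinner_diff_right)
  then show "h = g" by (simp add: cinner_self_eq_0)
qed (use g in simp)

lemma hcoeff_hmonom: "hcoeff (hmonom i j) (k, l) = (if k = i \<and> l = j then 1 else 0)"
  by (auto simp: hmonom_def)

lemma H_hom_iff: "f \<in> H_hom n \<longleftrightarrow> hcomp n f = f"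
proof
  have "{hmonom j (n - j) | j. j \<le> n} \<subseteq> {f. hcomp n f = f}"
    by (auto intro!: hardy_eqI simp: hcoeff_hmonom)
  moreover have "csubspace {f. hcomp n f = f}"
    by (auto simp: hardy.subspace_def hcomp_0 hcomp_add hcomp_scale)
  ultimately have "H_hom n \<subseteq> {f. hcomp n f = f}"
    unfolding H_hom_def by (rule hardy.span_minimal)
  then show "hcomp n f = f" if "f \<in> H_hom n" using that by blast
next
  assume f: "hcomp n f = f"
  have "f = (\<Sum>i\<le>n. hcoeff f (i, n - i) *\<^sub>C hmonom i (n - i))"
  proof (rule hardy_eqI)
    fix i j
    have *: "hcoeff f (i, j) = (if i + j = n then hcoeff f (i, j) else 0)"
      using arg_cong[OF f, of "\<lambda>f. hcoeff f (i, j)"] by simp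
    have "hcoeff (\<Sum>k\<le>n. hcoeff f (k, n - k) *\<^sub>C hmonom k (n - k)) (i, j) =
        (\<Sum>k\<le>n. if k = i then (if j = n - i then hcoeff f (i, j) else 0) else 0)"
      unfolding hcoeff_sum by (rule sum.cong) (auto simp: hcoeff_hmonom)
    also have "\<dots> = hcoeff f (i, j)" by (subst (2) *) auto
    finally show "hcoeff f (i, j) = hcoeff (\<Sum>k\<le>n. hcoeff f (k, n - k) *\<^sub>C hmonom k (n - k)) (i, j)" by simp
  qed
  also have "\<dots> \<in> H_hom n"
    unfolding H_hom_def
    by (intro hardy.span_sum hardy.span_scale hardy.span_base) auto
  finally show "f \<in> H_hom n" .
qed

section \<open>The quotient module of a homogeneous polynomial\<close>

lemma hardy_of_poly_add: "hardy_of_poly (r + s) = hardy_of_poly r + hardy_of_poly s"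
  by (rule hardy_eqI) simp

lemma hardy_of_poly_0: "hardy_of_poly 0 = 0"
  by (rule hardy_eqI) simp

locale homogeneous_symbol =
  fixes p :: "complex poly poly" and D :: nat
  assumes p_nonzero: "p \<noteq> 0" and homogeneous: "homogeneous_poly p D" and D_pos: "D \<ge> 1"
begin

definition q :: "complex poly" where "q = poly p 1"

text \<open>Setting w = 1 loses no information: homogeneity leaves a single exponent of w, namely
  \<open>D - i\<close>, beside each power z^i.\<close>

lemma coeff_q: "coeff q i = (if i \<le> D then coeff (coeff p (D - i)) i else 0)"
proof -
  have *: "coeff (coeff p j) i = 0" if "i + j \<noteq> D" for j
    using homogeneous that by (auto simp: homogeneous_poly_def)
  have "coeff q i = (\<Sum>j\<le>degree p. coeff (coeff p j) i)"
    by (simp add: q_def poly_altdef coeff_sum)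
  also have "\<dots> = (\<Sum>j\<in>(if i \<le> D then {D - i} else {}). coeff (coeff p j) i)"
    by (rule sum.mono_neutral_cong)
       (use * in \<open>auto simp: not_le coeff_eq_0 split: if_splits\<close>)
  finally show ?thesis by simp
qed

lemma degree_q: "degree q \<le> D"
  by (rule degree_le) (simp add: coeff_q)

lemma q_nonzero: "q \<noteq> 0"
proof
  assume "q = 0"
  then have q: "i \<le> D \<Longrightarrow> coeff (coeff p (D - i)) i = 0" for i
    using coeff_q[of i] by simp
  have "coeff (coeff p j) i = 0" for i j
  proof (rule ccontr)
    assume *: "coeff (coeff p j) i \<noteq> 0"
    then have "i + j = D" using homogeneous by (auto simp: homogeneous_poly_def)
    then show False using q[of i] * by auto
  qed
  then show False using p_nonzero by (auto simp: poly_eq_iff)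
qed

lemma degree_q_mult: "degree g \<le> n \<Longrightarrow> degree (q * g) \<le> D + n"
  using degree_mult_le[of q g] degree_q by linarith

text \<open>The passage from two variables to one: the exponent of w is remembered only through the
  degree of the homogenization.\<close>

lemma hardy_of_poly_monom:
  "hardy_of_poly (p * monom (monom c i) j) = hom (D + (i + j)) (q * monom c i)"
proof (rule hardy_eqI)
  fix k l
  have *: "coeff (coeff p b) a = 0" if "a + b \<noteq> D" for a b
    using homogeneous that by (auto simp: homogeneous_poly_def)
  have "coeff (coeff (p * monom (monom c i) j) l) k =
      (if j \<le> l \<and> i \<le> k then c * coeff (coeff p (l - j)) (k - i) else 0)"
    by (simp add: mult.commute[of p] coeff_monom_mult)
  moreover have "coeff (q * monom c i) k = (if i \<le> k then c * coeff q (k - i) else 0)"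
    by (simp add: mult.commute[of q] coeff_monom_mult)
  moreover have "D - (k - i) = l - j" if "i \<le> k" "k + l = D + (i + j)"
    using that by linarith
  moreover have "coeff (coeff p (l - j)) (k - i) = 0" if "i \<le> k" "j \<le> l" "k + l \<noteq> D + (i + j)"
    using that by (intro *) linarith
  ultimately show "hcoeff (hardy_of_poly (p * monom (monom c i) j)) (k, l) =
      hcoeff (hom (D + (i + j)) (q * monom c i)) (k, l)"
    by (auto simp: coeff_q)
qed

definition Q :: "hardy set" where "Q = Q_mod p"

text \<open>Since \<open>p\<close> is homogeneous, [p] is graded, so orthogonality can be tested one
  degree at a time. Both directions go through the monomials z^i w^j by linearity.\<close>

lemma Q_iff: "f \<in> Q \<longleftrightarrow> (\<forall>n g. degree g \<le> n \<longrightarrow> cinner f (hom (D + n) (q * g)) = 0)"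
proof -
  have Q: "Q = hperp {hardy_of_poly (p * r) | r. True}"
    by (simp add: Q_def Q_mod_def submodule_gen_def hperp_closure)
  have z: "cinner f (hom d (q * 0)) = 0" for d
    by (simp add: cinner_hom)
  show ?thesis
  proof
    assume f: "f \<in> Q"
    show "\<forall>n g. degree g \<le> n \<longrightarrow> cinner f (hom (D + n) (q * g)) = 0"
    proof (intro allI impI)
      fix n and g :: "complex poly" assume g: "degree g \<le> n"
      have "cinner f (hom (D + n) (q * (\<Sum>i\<in>A. monom (coeff g i) i))) = 0" if "A \<subseteq> {..n}" "finite A" for A
        using that(2,1)
      proof (induction A)
        case (insert i A)
        \<comment> \<open>The monomial z^i is completed by w^(n - i) to total degree
          \<open>n\<close>; this is where the degree bound on \<open>g\<close> enters.\<close>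
        have "cinner f (hardy_of_poly (p * monom (monom (coeff g i) i) (n - i))) = 0"
          using f by (auto simp: Q hperp_def)
        then have "cinner f (hom (D + n) (q * monom (coeff g i) i)) = 0"
          using insert.prems by (simp add: hardy_of_poly_monom)
        then show ?case using insert by (simp add: distrib_left hom_add cinner_simps)
      qed (use z in simp)
      from this[of "{..degree g}"] g have "cinner f (hom (D + n) (q * (\<Sum>i\<le>degree g. monom (coeff g i) i))) = 0"
        by simp
      then show "cinner f (hom (D + n) (q * g)) = 0" by (simp only: poly_as_sum_of_monoms)
    qed
  next
    assume f: "\<forall>n g. degree g \<le> n \<longrightarrow> cinner f (hom (D + n) (q * g)) = 0"
    let ?P = "\<lambda>r. cinner f (hardy_of_poly (p * r)) = 0"
    have P0: "?P 0" by (simp add: hardy_of_poly_0 cinner_simps)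
    have Padd: "?P (r + s)" if "?P r" "?P s" for r s
      using that by (simp add: distrib_left hardy_of_poly_add cinner_simps)
    have Psum: "?P (sum r A)" if "\<And>a. a \<in> A \<Longrightarrow> ?P (r a)" for r and A :: "nat set"
      using that by (induction A rule: infinite_finite_induct) (simp_all add: hardy_of_poly_0 cinner_simps Padd)
    have Pm: "?P (monom (monom c i) j)" for c i j
    proof -
      have "degree (monom c i) \<le> i + j" using degree_monom_le[of c i] by linarith
      then show ?thesis using f by (simp only: hardy_of_poly_monom)
    qed
    have "?P (monom s j)" for s j
    proof -
      have "monom (\<Sum>i\<le>degree s. monom (coeff s i) i) j = (\<Sum>i\<le>degree s. monom (monom (coeff s i) i) j)"
        by (rule monom_sum)
      moreover have "?P (\<Sum>i\<le>degree s. monom (monom (coeff s i) i) j)" by (rule Psum) (rule Pm)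
      ultimately show ?thesis by (simp only: poly_as_sum_of_monoms)
    qed
    then have "?P (\<Sum>j\<le>degree r. monom (coeff r j) j)" for r by (rule Psum)
    then have "?P r" for r by (simp only: poly_as_sum_of_monoms)
    then show "f \<in> Q" by (auto simp: Q hperp_def)
  qed
qed

lemma cinner_Q: "f \<in> Q \<Longrightarrow> degree g \<le> n \<Longrightarrow> cinner f (hom (D + n) (q * g)) = 0"
  by (simp add: Q_iff)

lemma Q_subspace: "csubspace Q"
  unfolding Q_def Q_mod_def by (rule csubspace_hperp)

lemma hom_in_hperp_Q:
  assumes "degree g \<le> n"
  shows "hom (D + n) (q * g) \<in> hperp Q"
  unfolding hperp_def
proof safe
  fix f assume "f \<in> Q"
  from arg_cong[OF cinner_Q[OF this assms], of cnj]
  show "cinner (hom (D + n) (q * g)) f = 0" by (simp only: cinner_cnj complex_cnj_zero)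
qed

lemma cinner_hcomp_hom: "cinner (hcomp d f) (hom e g) = (if d = e then cinner f (hom e g) else 0)"
  by (simp add: cinner_hcomp_right[symmetric] hcomp_hom cinner_simps)

lemma Q_hcomp: "f \<in> Q \<Longrightarrow> hcomp d f \<in> Q"
  by (simp add: Q_iff cinner_hcomp_hom)

lemma Q_hcompI:
  assumes "\<And>d. hcomp d f \<in> Q"
  shows "f \<in> Q"
  unfolding Q_iff
proof (intro allI impI)
  fix n and g :: "complex poly" assume "degree g \<le> n"
  then show "cinner f (hom (D + n) (q * g)) = 0"
    using cinner_Q[OF assms[of "D + n"], of g n] by (simp add: cinner_hcomp_hom)
qed

lemma hcomp_in_Q_small: "d < D \<Longrightarrow> hcomp d f \<in> Q"
  by (auto simp: Q_iff cinner_hcomp_hom)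

lemma hperp_Q_hcompI: assumes "\<And>d. hcomp d f \<in> hperp Q" shows "f \<in> hperp Q"
  unfolding hperp_def
proof (safe)
  fix g assume "g \<in> Q"
  then have eq: "cinner (hcomp d f) (hcomp d g) = 0" for d
    using assms[of d] Q_hcomp[of g d] by (auto simp: hperp_def)
  have "cinner f g = cinner 0 0"
    by (rule cinner_eq_hcompI) (simp add: eq hcomp_0 cinner_simps)
  then show "cinner f g = 0" by (simp add: cinner_simps)
qed

lemma cinner_back_z: "cinner (back_z f) g = cinner f (mult_z g)"
  using arg_cong[OF cinner_mult_z[of g f], of cnj] by (simp only: cinner_cnj)

lemma cinner_back_w: "cinner (back_w f) g = cinner f (mult_w g)"
  using arg_cong[OF cinner_mult_w[of g f], of cnj] by (simp only: cinner_cnj)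

text \<open>Multiplication by z maps [p] into itself, so its adjoint maps the orthogonal complement
  into itself.\<close>

lemma Q_back_z: assumes "f \<in> Q" shows "back_z f \<in> Q"
  unfolding Q_iff
proof (intro allI impI)
  fix n and g :: "complex poly" assume "degree g \<le> n"
  then have "degree (pCons 0 g) \<le> Suc n" by (simp add: degree_pCons_eq_if)
  from cinner_Q[OF assms this] show "cinner (back_z f) (hom (D + n) (q * g)) = 0"
    by (simp add: cinner_back_z mult_z_hom)
qed

section \<open>Each degree of [p] as a space of polynomials for the weighted measure\<close>

abbreviation "\<mu> \<equiv> circle_measure q"
abbreviation "\<phi> \<equiv> szego \<mu>"

sublocale mu: circle_prob \<mu>
  by (rule circle_prob_circle_measure[OF q_nonzero])

definition N :: real where "N = circle_norm q"

lemma N_pos: "N > 0"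
  unfolding N_def by (rule circle_norm_pos[OF q_nonzero])

lemma cinner_hom_hom: "degree f \<le> d \<Longrightarrow> cinner (hom d f) (hom d g) = poly_inner haar_circle f g"
  by (simp add: cinner_hom poly_inner_haar)

lemma cinner_hom_q:
  assumes "degree f \<le> n"
  shows "cinner (hom (D + n) (q * f)) (hom (D + n) (q * g)) = of_real (N\<^sup>2) * poly_inner \<mu> f g"
  using N_pos by (simp add: cinner_hom_hom degree_q_mult assms poly_inner_circle_measure N_def)

text \<open>
  Write $[p]_d = [p] \cap H_d$.  Since $\varphi_n$ and $\varphi_n^*$ are orthogonal, respectively, to the polynomials of degree
  below \<open>n\<close> and to the multiples of $\zeta$ of degree at most \<open>n\<close>, the unit vectors \<open>E d\<close> and \<open>E' d\<close>
  span $[p]_d \ominus w[p]_{d-1}$ and $[p]_d \ominus z[p]_{d-1}$ for $d \ge D$.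
\<close>

definition E :: "nat \<Rightarrow> hardy"
  where "E d = (if d < D then 0 else of_real (1 / N) *\<^sub>C hom d (q * \<phi> (d - D)))"

definition E' :: "nat \<Rightarrow> hardy"
  where "E' d = (if d < D then 0 else of_real (1 / N) *\<^sub>C hom d (q * crev (d - D) (\<phi> (d - D))))"

lemma E_D: "E (D + n) = of_real (1 / N) *\<^sub>C hom (D + n) (q * \<phi> n)"
  and E'_D: "E' (D + n) = of_real (1 / N) *\<^sub>C hom (D + n) (q * crev n (\<phi> n))"
  by (simp_all add: E_def E'_def)

lemma hcomp_E: "hcomp d (E e) = (if d = e then E d else 0)"
  and hcomp_E': "hcomp d (E' e) = (if d = e then E' d else 0)"
  by (auto simp: E_def E'_def hcomp_0 hcomp_scale hcomp_hom)

lemma degree_phi: "degree (\<phi> n) \<le> n"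
  by (simp add: mu.degree_szego)

lemma poly_inner_phi: "poly_inner \<mu> (\<phi> n) (\<phi> n) = 1" "poly_inner \<mu> (crev n (\<phi> n)) (crev n (\<phi> n)) = 1"
  using mu.is_szego_szego[of n] by (simp_all add: is_szego_def mu.poly_inner_crev_crev degree_phi)

lemma cinner_E_E: "cinner (E (D + n)) (E (D + n)) = 1" "cinner (E' (D + n)) (E' (D + n)) = 1"
  using N_pos
  by (simp_all add: E_D E'_D cinner_simps cinner_hom_q degree_phi degree_crev poly_inner_phi power2_eq_square)

lemma norm_E: "norm (E (D + n)) = 1" "norm (E' (D + n)) = 1"
proof -
  have "complex_of_real ((norm (E (D + n)))\<^sup>2) = of_real 1" "complex_of_real ((norm (E' (D + n)))\<^sup>2) = of_real 1"
    unfolding cinner_self[symmetric] cinner_E_E by simp_all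
  then have "(norm (E (D + n)))\<^sup>2 = 1" "(norm (E' (D + n)))\<^sup>2 = 1"
    unfolding of_real_eq_iff by simp_all
  then show "norm (E (D + n)) = 1" "norm (E' (D + n)) = 1"
    using power2_eq_imp_eq[of "norm (E (D + n))" 1] power2_eq_imp_eq[of "norm (E' (D + n))" 1] by simp_all
qed

lemma E_in_hperp: "E d \<in> hperp Q" "E' d \<in> hperp Q"
proof -
  have D: "E (D + n) \<in> hperp Q" "E' (D + n) \<in> hperp Q" for n
    unfolding E_D E'_D
    by (intro hardy.subspace_scale[OF csubspace_hperp] hom_in_hperp_Q degree_phi degree_crev)+
  have "0 \<in> hperp Q" by (rule hardy.subspace_0[OF csubspace_hperp])
  then have "E d \<in> hperp Q \<and> E' d \<in> hperp Q"
    using D[of "d - D"] by (cases "d < D") (simp_all add: E_def E'_def)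
  then show "E d \<in> hperp Q" "E' d \<in> hperp Q" by auto
qed

lemma norm_E_le: "norm (E d) \<le> 1" "norm (E' d) \<le> 1"
  using norm_E[of "d - D"] by (auto simp: E_def E'_def)

text \<open>Common to both compressions. By the hypothesis \<open>split\<close>, elements of [p] in
  degree \<open>D + n\<close> are multiples of the unit vector \<open>e (D + n)\<close> up to
  vectors orthogonal to it and to \<open>f\<close>. So the projection of \<open>f\<close> to [p] has
  the components <f, e_d> e_d, and Cauchy-Schwarz gives the bound that \<open>hardy_glue\<close>
  asks for.\<close>

lemma projection_exists:
  assumes e: "\<And>d. hcomp d (e d) = e d" "\<And>d. norm (e d) \<le> 1" "\<And>d. e d \<in> hperp Q"
    and e1: "\<And>n. cinner (e (D + n)) (e (D + n)) = 1"
    and split: "\<And>n g. degree g \<le> n \<Longrightarrow>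
      \<exists>c k. hom (D + n) (q * g) = c *\<^sub>C e (D + n) + k \<and> cinner f k = 0 \<and> cinner (e (D + n)) k = 0"
  shows "\<exists>G. (\<forall>d. hcomp d G = cinner f (e d) *\<^sub>C e d) \<and> f - G \<in> Q \<and> hproj Q f = f - G"
proof -
  let ?x = "\<lambda>d. cinner f (e d) *\<^sub>C e d"
  have x: "hcomp d (?x d) = ?x d" for d by (simp add: hcomp_scale e)
  have le: "norm (?x d) \<le> norm (hcomp d f)" for d
  proof -
    have "cinner f (e d) = cinner (hcomp d f) (e d)" by (metis cinner_hcomp_right e(1))
    then have "cmod (cinner f (e d)) \<le> norm (hcomp d f) * norm (e d)" by (simp add: cinner_cauchy_schwarz)
    also have "\<dots> \<le> norm (hcomp d f)" using e(2)[of d] by (simp add: mult_left_le)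
    finally have "cmod (cinner f (e d)) * norm (e d) \<le> norm (hcomp d f) * 1"
      using e(2)[of d] by (intro mult_mono) auto
    then show ?thesis by (simp add: norm_cscale)
  qed
  obtain G where G: "\<And>d. hcomp d G = ?x d"
    using hardy_glue[of ?x f, OF x le] by blast
  have "G \<in> hperp Q"
    by (rule hperp_Q_hcompI) (simp add: G hardy.subspace_scale[OF csubspace_hperp] e(3))
  moreover have "f - G \<in> Q"
    unfolding Q_iff
  proof (intro allI impI)
    fix n and g :: "complex poly" assume "degree g \<le> n"
    from split[OF this] obtain c k where k: "hom (D + n) (q * g) = c *\<^sub>C e (D + n) + k"
      "cinner f k = 0" "cinner (e (D + n)) k = 0" by blast
    have "cinner G (hom (D + n) (q * g)) = cinner (hcomp (D + n) G) (hom (D + n) (q * g))"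
      by (simp add: cinner_hcomp_hom)
    also have "\<dots> = cinner f (hom (D + n) (q * g))"
      unfolding G k(1) by (simp add: cinner_simps e1 k)
    finally show "cinner (f - G) (hom (D + n) (q * g)) = 0" by (simp add: cinner_simps)
  qed
  ultimately show ?thesis using G by (intro exI[of _ G]) (auto intro!: hproj_eqI Q_subspace)
qed

text \<open>The part of \<open>g\<close> below degree \<open>n\<close> yields w times a vector k' of
  [p], and <wf, wk'> = <f, k'> = 0 for \<open>f\<close> in \<open>Q\<close>.\<close>

lemma split_w:
  assumes f: "f \<in> Q" and g: "degree g \<le> n"
  shows "\<exists>c k. hom (D + n) (q * g) = c *\<^sub>C E (D + n) + k \<and> cinner (mult_w f) k = 0 \<and> cinner (E (D + n)) k = 0"
proof -
  obtain c h where h: "g = smult c (\<phi> n) + h" "deg_below h n"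
    using mu.szego_decomp[OF mu.is_szego_szego g] .
  let ?k = "hom (D + n) (q * h)"
  have "hom (D + n) (q * g) = (c * of_real N) *\<^sub>C E (D + n) + ?k"
    using N_pos by (simp add: h(1) distrib_left hom_add hom_smult E_D)
  moreover have "cinner (E (D + n)) ?k = 0"
    using mu.is_szego_szego[of n] h(2) by (simp add: E_D cinner_simps cinner_hom_q degree_phi is_szego_def)
  moreover have "cinner (mult_w f) ?k = 0"
  proof (cases n)
    case 0
    then have "h = 0" using h(2) by (intro poly_eqI) simp
    then show ?thesis by (simp add: cinner_hom)
  next
    case (Suc m)
    then have "degree h \<le> m" using h(2) by (simp add: deg_below_Suc_iff)
    \<comment> \<open>Multiplication by w keeps the polynomial in one variable and raises only the
      degree of its homogenization.\<close>
    moreover from this have "?k = mult_w (hom (D + m) (q * h))" by (simp add: Suc mult_w_hom degree_q_mult)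
    ultimately show ?thesis using cinner_Q[OF f] by (simp add: cinner_mult_w back_w_mult_w)
  qed
  ultimately show ?thesis by blast
qed

text \<open>Mirror image of \<open>split_w\<close>: multiplication by z is multiplication by the
  variable, so the reversed polynomial takes over the role of phi_n.\<close>

lemma split_z:
  assumes f: "f \<in> Q" and g: "degree g \<le> n"
  shows "\<exists>c k. hom (D + n) (q * g) = c *\<^sub>C E' (D + n) + k \<and> cinner (mult_z f) k = 0 \<and> cinner (E' (D + n)) k = 0"
proof -
  obtain c h where h: "g = smult c (crev n (\<phi> n)) + pCons 0 h" "deg_below h n"
    using mu.crev_decomp[OF mu.is_szego_szego g] .
  let ?k = "hom (D + n) (q * pCons 0 h)"
  have "hom (D + n) (q * g) = (c * of_real N) *\<^sub>C E' (D + n) + ?k"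
    using N_pos by (simp add: h(1) distrib_left hom_add hom_smult E'_D del: mult_pCons_right)
  moreover have "cinner (E' (D + n)) ?k = 0"
    using mu.crev_orth[OF mu.is_szego_szego h(2)]
    by (simp add: E'_D cinner_simps cinner_hom_q degree_crev del: mult_pCons_right)
  moreover have "cinner (mult_z f) ?k = 0"
  proof (cases n)
    case 0
    then have "h = 0" using h(2) by (intro poly_eqI) simp
    then show ?thesis by (simp add: cinner_hom)
  next
    case (Suc m)
    then have "degree h \<le> m" using h(2) by (simp add: deg_below_Suc_iff)
    moreover have "?k = mult_z (hom (D + m) (q * h))" by (simp add: Suc mult_z_hom)
    ultimately show ?thesis using cinner_Q[OF f] by (simp add: cinner_mult_z back_z_mult_z)
  qed
  ultimately show ?thesis by blast
qed

lemma S_w_exists: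
  assumes "f \<in> Q"
  shows "\<exists>G. (\<forall>d. hcomp d G = cinner (mult_w f) (E d) *\<^sub>C E d) \<and> S_w p f \<in> Q \<and> S_w p f = mult_w f - G"
proof -
  have "\<exists>G. (\<forall>d. hcomp d G = cinner (mult_w f) (E d) *\<^sub>C E d) \<and> mult_w f - G \<in> Q \<and>
      hproj Q (mult_w f) = mult_w f - G"
    by (rule projection_exists)
       (simp_all add: hcomp_E norm_E_le E_in_hperp cinner_E_E split_w[OF assms])
  then obtain G where G: "\<And>d. hcomp d G = cinner (mult_w f) (E d) *\<^sub>C E d"
    "mult_w f - G \<in> Q" "hproj Q (mult_w f) = mult_w f - G" by blast
  then show ?thesis by (intro exI[of _ G]) (simp_all add: S_w_def flip: Q_def)
qed

text \<open>\<open>S_z\<close> enters only through its adjoint, for which it is enough to know that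
  the discarded part \<open>G\<close> is orthogonal to \<open>Q\<close>.\<close>

lemma S_z_exists:
  assumes "f \<in> Q"
  obtains G where "S_z p f \<in> Q" "S_z p f = mult_z f - G" "G \<in> hperp Q"
proof -
  have "\<exists>G. (\<forall>d. hcomp d G = cinner (mult_z f) (E' d) *\<^sub>C E' d) \<and> mult_z f - G \<in> Q \<and>
      hproj Q (mult_z f) = mult_z f - G"
    by (rule projection_exists)
       (simp_all add: hcomp_E' norm_E_le E_in_hperp cinner_E_E split_z[OF assms])
  then obtain G where G: "\<And>d. hcomp d G = cinner (mult_z f) (E' d) *\<^sub>C E' d"
    "mult_z f - G \<in> Q" "hproj Q (mult_z f) = mult_z f - G" by blast
  have "G \<in> hperp Q"
    by (rule hperp_Q_hcompI) (simp add: G hardy.subspace_scale[OF csubspace_hperp] E_in_hperp)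
  with G(2,3) show ?thesis by (intro that[of G]) (simp_all add: S_z_def flip: Q_def)
qed

text \<open>The part of zu discarded by the projection is orthogonal to \<open>f\<close>, so
  \<open>S_z\<close> may be replaced by \<open>mult_z\<close>, whose adjoint leaves \<open>Q\<close>
  invariant.\<close>

lemma adj_S_z: "f \<in> Q \<Longrightarrow> adj_on Q (S_z p) f = back_z f"
proof (rule adj_on_eqI[OF Q_subspace Q_back_z])
  fix u assume f: "f \<in> Q" and u: "u \<in> Q"
  from u obtain G where G: "S_z p u \<in> Q" "S_z p u = mult_z u - G" "G \<in> hperp Q" by (rule S_z_exists[of u])
  have "cinner G f = 0" using G f by (simp add: hperp_def)
  then show "cinner (S_z p u) f = cinner u (back_z f)" by (simp add: G cinner_simps cinner_mult_z)
qed

section \<open>The commutator as an orthogonal sum of rank-one blocks\<close>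

lemma S_w_in_Q: "f \<in> Q \<Longrightarrow> S_w p f \<in> Q"
  using S_w_exists by blast

lemma Y_op_eq: "f \<in> Q \<Longrightarrow> Y_op p f = back_z (S_w p f) - S_w p (back_z f)"
  unfolding Y_op_def Q_def[symmetric] by (simp add: adj_S_z S_w_in_Q)

text \<open>For $m = D + n - 1$ this is $\langle\varphi_n, \varphi_n^*\rangle$.\<close>

definition refl_coeff :: "nat \<Rightarrow> complex"
  where "refl_coeff m = (if Suc m \<le> D then 1 else - cnj (szego_alpha \<mu> (m - D)))"

text \<open>The index is \<open>Suc m\<close> because a backward shift lowers the degree by one:
  degree m = D + n - 1 receives from degree D + n.\<close>

definition u :: "nat \<Rightarrow> hardy" where "u m = back_w (E (Suc m))"
text \<open>An explicit form of the projection of \<open>back_z (E (Suc m))\<close> to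
  \<open>Q\<close>: by \<open>back_z_E\<close> the two differ by a multiple of \<open>E m\<close>,
  which is orthogonal to \<open>Q\<close>.\<close>

definition v :: "nat \<Rightarrow> hardy" where "v m = refl_coeff m *\<^sub>C back_z (E' (Suc m))"

lemma hcomp_u: "hcomp d (u m) = (if d = m then u m else 0)"
  and hcomp_v: "hcomp d (v m) = (if d = m then v m else 0)"
  by (auto simp: u_def v_def hcomp_scale hcomp_back_z hcomp_back_w hcomp_E hcomp_E' back_w_0 back_z_0)

lemma cinner_hom_diff: "d \<noteq> e \<Longrightarrow> cinner (hom d f) (hom e g) = 0"
  by (metis cinner_hcomp_hom hcomp_hom)

text \<open>Moving the shift to the other side asks that \<open>E (Suc m)\<close> be orthogonal to
  w[p]; in the matching degree this is phi_{n+1} against polynomials of degree at most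
  \<open>n\<close>.\<close>

lemma u_in_Q: "u m \<in> Q"
  unfolding Q_iff
proof (intro allI impI)
  fix n and g :: "complex poly" assume g: "degree g \<le> n"
  have *: "cinner (u m) (hom (D + n) (q * g)) = cinner (E (Suc m)) (hom (D + Suc n) (q * g))"
    using g by (simp add: u_def cinner_back_w mult_w_hom degree_q_mult)
  show "cinner (u m) (hom (D + n) (q * g)) = 0"
  proof (cases "Suc m = D + Suc n")
    case True
    have "deg_below g (Suc n)" using g by (simp add: deg_below_Suc_iff)
    then show ?thesis unfolding * unfolding True E_D
      using mu.is_szego_szego[of "Suc n"]
      by (simp only: cinner_simps cinner_hom_q degree_phi is_szego_def) simp
  next
    case False
    then show ?thesis unfolding * unfolding E_def by (auto simp: cinner_simps cinner_hom_diff)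
  qed
qed

text \<open>As for \<open>u\<close>, with z[p] in place of w[p]: the reversed polynomial is
  orthogonal to the multiples of the variable.\<close>

lemma v_in_Q: "v m \<in> Q"
  unfolding v_def
proof (intro hardy.subspace_scale[OF Q_subspace], unfold Q_iff, intro allI impI)
  fix n and g :: "complex poly" assume g: "degree g \<le> n"
  have *: "cinner (back_z (E' (Suc m))) (hom (D + n) (q * g)) = cinner (E' (Suc m)) (hom (D + Suc n) (q * pCons 0 g))"
    by (simp add: cinner_back_z mult_z_hom)
  show "cinner (back_z (E' (Suc m))) (hom (D + n) (q * g)) = 0"
  proof (cases "Suc m = D + Suc n")
    case True
    have "deg_below g (Suc n)" using g by (simp add: deg_below_Suc_iff)
    then show ?thesis unfolding * unfolding True E'_D
      using mu.crev_orth[OF mu.is_szego_szego[of "Suc n"], of g]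
      by (simp only: cinner_simps cinner_hom_q degree_crev) simp
  next
    case False
    then show ?thesis unfolding * unfolding E'_def by (auto simp: cinner_simps cinner_hom_diff)
  qed
qed

lemma back_z_E: "\<exists>r. back_z (E (Suc m)) = v m + r *\<^sub>C E m"
proof (cases "Suc m \<le> D")
  case True
  \<comment> \<open>If \<open>Suc m < D\<close> both vectors are 0; if \<open>Suc m = D\<close> they
    come from phi_0 = 1, which is its own reversal.\<close>
  have "crev 0 1 = 1" by (rule poly_eqI) (auto simp: coeff_crev)
  then have "E (Suc m) = E' (Suc m)" using True by (auto simp: E_def E'_def)
  then show ?thesis using True by (intro exI[of _ 0]) (simp add: v_def refl_coeff_def)
next
  case False
  then obtain k where k: "m = D + k" by (metis le_iff_add not_less_eq_eq)
  let ?r = "complex_of_real (szego_rho \<mu> k)" and ?a = "szego_alpha \<mu> k"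
  have "E (Suc m) = of_real (1 / N) *\<^sub>C hom (D + Suc k) (q * \<phi> (Suc k))"
    using E_D[of "Suc k"] by (simp add: k)
  also have "q * \<phi> (Suc k) = smult ?r (pCons 0 (q * \<phi> k)) - smult (cnj ?a) (q * crev (Suc k) (\<phi> (Suc k)))"
    by (subst mu.szego_inverse_recursion) (simp add: right_diff_distrib)
  also have "of_real (1 / N) *\<^sub>C hom (D + Suc k) \<dots> = ?r *\<^sub>C mult_z (E m) - cnj ?a *\<^sub>C E' (Suc m)"
    using E'_D[of "Suc k"]
    by (intro hardy_eqI) (simp add: k E_D right_diff_distrib diff_divide_distrib coeff_pCons split: nat.splits)
  finally have "back_z (E (Suc m)) = ?r *\<^sub>C E m - cnj ?a *\<^sub>C back_z (E' (Suc m))"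
    by (simp add: back_z_diff back_z_scale back_z_mult_z)
  then show ?thesis
    by (intro exI[of _ ?r]) (simp add: v_def refl_coeff_def k)
qed

lemma Y_op_in_Q: "f \<in> Q \<Longrightarrow> Y_op p f \<in> Q"
  by (simp add: Y_op_eq hardy.subspace_diff[OF Q_subspace] Q_back_z S_w_in_Q)

lemma hcomp_Y_op:
  assumes f: "f \<in> Q"
  shows "hcomp m (Y_op p f) = - (cinner f (u m)) *\<^sub>C v m"
proof -
  obtain G where G: "\<And>d. hcomp d G = cinner (mult_w f) (E d) *\<^sub>C E d" "S_w p f \<in> Q" "S_w p f = mult_w f - G"
    using S_w_exists[OF f] by blast
  obtain H where H: "\<And>d. hcomp d H = cinner (mult_w (back_z f)) (E d) *\<^sub>C E d" "S_w p (back_z f) \<in> Q" "S_w p (back_z f) = mult_w (back_z f) - H"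
    using S_w_exists[OF Q_back_z[OF f]] by blast
  obtain r where r: "back_z (E (Suc m)) = v m + r *\<^sub>C E m" using back_z_E by blast
  \<comment> \<open>Since \<open>back_z\<close> commutes with \<open>mult_w\<close>, the main terms
    cancel and only the parts discarded by the two projections remain.\<close>
  have "Y_op p f = H - back_z G"
    by (simp add: Y_op_eq[OF f] G H back_z_diff back_z_mult_w)
  then have "hcomp m (Y_op p f) = cinner (mult_w (back_z f)) (E m) *\<^sub>C E m - cinner f (u m) *\<^sub>C (v m + r *\<^sub>C E m)"
    by (simp add: hcomp_diff hcomp_back_z G H back_z_scale r cinner_mult_w u_def)
  \<comment> \<open>The multiple of \<open>E m\<close> vanishes: it lies in \<open>Q\<close>, as all other terms do, and is orthogonal to it.\<close>
  moreover define t where "t = cinner (mult_w (back_z f)) (E m) - cinner f (u m) * r"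
  ultimately have t: "hcomp m (Y_op p f) = t *\<^sub>C E m - cinner f (u m) *\<^sub>C v m"
    by (simp add: hardy.scale_left_diff_distrib hardy.scale_right_distrib)
  have "t *\<^sub>C E m = hcomp m (Y_op p f) + cinner f (u m) *\<^sub>C v m" by (simp add: t)
  moreover have "hcomp m (Y_op p f) + cinner f (u m) *\<^sub>C v m \<in> Q"
    by (intro hardy.subspace_add hardy.subspace_scale Q_subspace Q_hcomp Y_op_in_Q f v_in_Q)
  ultimately have "t *\<^sub>C E m \<in> Q" by simp
  then have "t *\<^sub>C E m = 0"
    by (rule hperp_self) (rule hardy.subspace_scale[OF csubspace_hperp E_in_hperp(1)])
  then show ?thesis using t by simp
qed

end

section \<open>Singular values of the commutator\<close>

lemma norm_hom: "(norm (hom d f))\<^sup>2 = (\<Sum>i\<le>d. (cmod (coeff f i))\<^sup>2)"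
  using norm_hcomp[of d "hom d f"] by (simp add: hcomp_hom)

lemma cinner_component: "hcomp d g = g \<Longrightarrow> cinner f g = cinner (hcomp d f) g"
  using cinner_hcomp_right[of f d g] by simp

text \<open>H_m is the orthogonal complement of all components of other degrees, and orthogonal
  complements are closed.\<close>

lemma closed_H_hom: "closed (H_hom m)"
proof -
  have "H_hom m = hperp {hcomp d g | d g. d \<noteq> m}"
  proof (intro set_eqI iffI)
    fix f assume "f \<in> H_hom m"
    then have "hcomp d f = 0" if "d \<noteq> m" for d
      using that hcomp_hcomp[of d m f] by (simp add: H_hom_iff)
    then show "f \<in> hperp {hcomp d g | d g. d \<noteq> m}"
      by (auto simp: hperp_def cinner_hcomp_right cinner_simps)
  next
    fix f assume f: "f \<in> hperp {hcomp d g | d g. d \<noteq> m}"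
    have z: "hcomp d f = 0" if "d \<noteq> m" for d
    proof -
      have "cinner f (hcomp d f) = 0" using f that by (auto simp: hperp_def)
      then have "cinner (hcomp d f) (hcomp d f) = 0"
        unfolding cinner_hcomp_both by (simp only: cinner_hcomp_right)
      then show ?thesis by (simp add: cinner_self_eq_0)
    qed
    have "hcomp m f = f"
      by (rule hardy_eq_hcompI) (simp add: hcomp_hcomp z)
    then show "f \<in> H_hom m" by (simp add: H_hom_iff)
  qed
  then show ?thesis by (simp add: closed_hperp)
qed

lemma csubspace_H_hom: "csubspace (H_hom m)"
  unfolding H_hom_def by (rule hardy.subspace_span)

text \<open>Turns the dimension of an eigenspace into a count of degrees: each degree in
  \<open>F\<close> contributes one line, the others nothing, and non-zero vectors of different
  degrees are independent.\<close>

lemma has_cdim_graded: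
  fixes u :: "nat \<Rightarrow> hardy"
  assumes F: "finite F" and u: "\<And>d. d \<in> F \<Longrightarrow> hcomp d (u d) = u d" "\<And>d. d \<in> F \<Longrightarrow> u d \<noteq> 0"
    and S: "csubspace S" "\<And>d. d \<in> F \<Longrightarrow> u d \<in> S"
    and comp: "\<And>f d. f \<in> S \<Longrightarrow> d \<in> F \<Longrightarrow> \<exists>c. hcomp d f = c *\<^sub>C u d"
    and comp0: "\<And>f d. f \<in> S \<Longrightarrow> d \<notin> F \<Longrightarrow> hcomp d f = 0"
  shows "has_cdim S (card F)"
proof -
  have hu: "hcomp d (u e) = (if d = e then u e else 0)" if "e \<in> F" for d e
    using hcomp_hcomp[of d e "u e"] u(1)[OF that] by (simp split: if_splits)
  have hsum: "hcomp d (\<Sum>e\<in>A. c e *\<^sub>C u e) = (if d \<in> A then c d *\<^sub>C u d else 0)" if "A \<subseteq> F" for A c d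
    using finite_subset[OF that F] that
    by (induction A rule: finite_induct) (auto simp: hcomp_0 hcomp_add hcomp_scale hu)
  \<comment> \<open>Only the zero vector is homogeneous of two degrees, so the image has as many
    elements as \<open>F\<close>.\<close>
  have inj: "inj_on u F"
  proof (rule inj_onI, rule ccontr)
    fix d e assume *: "d \<in> F" "e \<in> F" "u d = u e" "d \<noteq> e"
    then have "u d = hcomp d (u e)" using u(1)[of d] by simp
    also have "\<dots> = 0" using hu[of e d] * by simp
    finally show False using u(2) * by blast
  qed
  have "\<not> cdependent (u ` F)"
  proof (rule hardy.independent_if_scalars_zero)
    fix c x assume s: "(\<Sum>x\<in>u ` F. c x *\<^sub>C x) = 0" and "x \<in> u ` F"
    then obtain d where d: "d \<in> F" "x = u d" by auto
    have "(\<Sum>e\<in>F. c (u e) *\<^sub>C u e) = 0" using s by (simp add: sum.reindex[OF inj])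
    then have "c (u d) *\<^sub>C u d = 0" using hsum[of F d "\<lambda>e. c (u e)"] d by (simp add: hcomp_0)
    then show "c x = 0" using u(2) d by simp
  qed (use F in simp)
  moreover have "cspan (u ` F) = S"
  proof
    show "cspan (u ` F) \<subseteq> S" by (rule hardy.span_minimal) (use S in auto)
    show "S \<subseteq> cspan (u ` F)"
    proof
      fix f assume f: "f \<in> S"
      then have "\<forall>d\<in>F. \<exists>c. hcomp d f = c *\<^sub>C u d" using comp by blast
      then obtain c where c: "\<And>d. d \<in> F \<Longrightarrow> hcomp d f = c d *\<^sub>C u d" by metis
      have "f = (\<Sum>d\<in>F. c d *\<^sub>C u d)"
        by (rule hardy_eq_hcompI) (simp add: hsum c comp0 f)
      also have "\<dots> \<in> cspan (u ` F)"
        by (intro hardy.span_sum hardy.span_scale hardy.span_base) auto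
      finally show "f \<in> cspan (u ` F)" .
    qed
  qed
  ultimately show ?thesis
    unfolding has_cdim_def using F by (intro exI[of _ "u ` F"]) (simp add: card_image[OF inj])
qed

section \<open>The norms of the rank-one blocks and the numbers beta_n\<close>

context homogeneous_symbol
begin

text \<open>The index is built from \<open>D\<close>, not from \<open>degree q\<close>; if the
  latter is smaller, both sides are 0.\<close>

lemma coeff_q_phi: "coeff (q * \<phi> n) (D + n) = coeff q D * of_real (mu.szego_kappa n)"
proof -
  have "coeff (q * \<phi> n) (D + n) = (\<Sum>i\<le>D + n. if i = D then coeff q D * coeff (\<phi> n) n else 0)"
    unfolding coeff_mult
  proof (rule sum.cong[OF refl])
    fix i assume "i \<in> {..D + n}"
    show "coeff q i * coeff (\<phi> n) (D + n - i) = (if i = D then coeff q D * coeff (\<phi> n) n else 0)"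
    proof (cases i D rule: linorder_cases)
      case less
      then have "coeff (\<phi> n) (D + n - i) = 0" by (intro coeff_eq_0) (simp add: mu.degree_szego)
      then show ?thesis using less by simp
    qed (use degree_q in \<open>auto simp: coeff_eq_0\<close>)
  qed
  then show ?thesis by (simp add: mu.coeff_szego)
qed

lemma norm_u: "(norm (u (D + n - 1)))\<^sup>2 = 1 - b_par D q * (mu.szego_kappa n)\<^sup>2"
proof -
  let ?P = "smult (of_real (1 / N)) (q * \<phi> n)" and ?m = "D + n - 1"
  \<comment> \<open>\<open>D \<ge> 1\<close> keeps the truncated subtraction exact, also for n =
    0.\<close>
  have m: "Suc ?m = D + n" using D_pos by simp
  have E: "E (Suc ?m) = hom (Suc ?m) ?P" unfolding m E_D hom_smult ..
  have "(norm (u ?m))\<^sup>2 = (\<Sum>i\<le>?m. (cmod (coeff ?P i))\<^sup>2)"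
    unfolding u_def E back_w_hom by (rule norm_hom)
  moreover have "(norm (E (Suc ?m)))\<^sup>2 = (\<Sum>i\<le>Suc ?m. (cmod (coeff ?P i))\<^sup>2)"
    unfolding E by (rule norm_hom)
  moreover have "norm (E (Suc ?m)) = 1" unfolding m by (rule norm_E)
  moreover have "(cmod (coeff ?P (Suc ?m)))\<^sup>2 = b_par D q * (mu.szego_kappa n)\<^sup>2"
    unfolding m by (simp add: coeff_q_phi b_par_def N_def norm_mult norm_divide power_mult_distrib power_divide)
  ultimately show ?thesis unfolding sum.atMost_Suc by (simp only:) simp
qed

lemma norm_back_z_E': "(norm (back_z (E' (D + n))))\<^sup>2 = 1 - a_par q * (mu.szego_kappa n)\<^sup>2"
proof -
  let ?P = "smult (of_real (1 / N)) (q * crev n (\<phi> n))" and ?m = "D + n - 1"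
  have m: "Suc ?m = D + n" using D_pos by simp
  have E: "E' (Suc ?m) = hom (Suc ?m) ?P" unfolding m E'_D hom_smult ..
  have "(norm (back_z (E' (Suc ?m))))\<^sup>2 = (\<Sum>i\<le>?m. (cmod (coeff (poly_shift 1 ?P) i))\<^sup>2)"
    unfolding E back_z_hom by (rule norm_hom)
  moreover have "(norm (E' (Suc ?m)))\<^sup>2 = (\<Sum>i\<le>Suc ?m. (cmod (coeff ?P i))\<^sup>2)"
    unfolding E by (rule norm_hom)
  moreover have "norm (E' (Suc ?m)) = 1" unfolding m by (rule norm_E)
  \<comment> \<open>The constant coefficient of \<open>crev n (\<phi> n)\<close> is kappa_n, so
    \<open>back_z\<close> loses the coefficient q_0 kappa_n / N.\<close>
  moreover have "(cmod (coeff ?P 0))\<^sup>2 = a_par q * (mu.szego_kappa n)\<^sup>2"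
    by (simp add: coeff_mult coeff_crev mu.coeff_szego a_par_def N_def norm_mult norm_divide
        power_mult_distrib power_divide)
  ultimately have "(norm (back_z (E' (Suc ?m))))\<^sup>2 = 1 - a_par q * (mu.szego_kappa n)\<^sup>2"
    unfolding sum.atMost_Suc_shift coeff_poly_shift by (simp only: Suc_eq_plus1) simp
  then show ?thesis unfolding m .
qed

lemma norm_v: "(norm (v (D + n - 1)))\<^sup>2 =
  (cmod (refl_coeff (D + n - 1)))\<^sup>2 * (1 - a_par q * (mu.szego_kappa n)\<^sup>2)"
proof -
  have "Suc (D + n - 1) = D + n" using D_pos by simp
  then show ?thesis by (simp only: v_def norm_cscale power_mult_distrib norm_back_z_E')
qed

text \<open>The value kappa_0 = 1 absorbs the separate case n = 0 of
  \<open>radicand\<close>.\<close>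

lemma radicand_eq: "radicand D q n = (1 - a_par q * (mu.szego_kappa n)\<^sup>2) * (1 - b_par D q * (mu.szego_kappa n)\<^sup>2)"
proof -
  have "mu.szego_kappa 0 = 1" by (simp add: mu.szego_kappa_def)
  then show ?thesis by (simp add: radicand_def mu.kappa_eq)
qed

lemma radicand_factors:
  "0 \<le> 1 - a_par q * (mu.szego_kappa n)\<^sup>2" "0 \<le> 1 - b_par D q * (mu.szego_kappa n)\<^sup>2"
  by (simp_all only: zero_le_power2 flip: norm_u norm_back_z_E')

lemma radicand_nonneg: "radicand D q n \<ge> 0"
  unfolding radicand_eq by (intro mult_nonneg_nonneg radicand_factors)

lemma refl_coeff_eq: "cmod (refl_coeff (D + n - 1)) = (if n = 0 then 1 else cmod (verblunsky \<mu> (n - 1)))"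
  using D_pos by (auto simp: refl_coeff_def mu.verblunsky_eq)

text \<open>The product on the right is the singular value of the rank-one operator that sends f to
  -<f, u> v.\<close>

lemma beta_eq: "beta D p n = norm (u (D + n - 1)) * norm (v (D + n - 1))"
proof -
  let ?A = "1 - a_par q * (mu.szego_kappa n)\<^sup>2" and ?B = "1 - b_par D q * (mu.szego_kappa n)\<^sup>2"
  let ?c = "cmod (refl_coeff (D + n - 1))"
  have "beta D p n = ?c * sqrt (?A * ?B)"
    unfolding beta_def q_def[symmetric] radicand_eq refl_coeff_eq by simp
  also have "\<dots> = sqrt ((norm (u (D + n - 1)) * norm (v (D + n - 1)))\<^sup>2)"
    unfolding power_mult_distrib norm_u norm_v by (simp add: real_sqrt_mult)
  finally show ?thesis by simp
qed

lemma u_small: "Suc m < D \<Longrightarrow> u m = 0"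
  by (simp add: u_def E_def back_w_0)

lemma cinner_u: "cinner f (u d) = cinner (hcomp d f) (u d)"
  and cinner_v: "cinner f (v d) = cinner (hcomp d f) (v d)"
  by (rule cinner_component, simp add: hcomp_u hcomp_v)+

lemma cmod_refl_coeff_le: "cmod (refl_coeff m) \<le> 1"
  using mu.szego_alpha_less_1 by (auto simp: refl_coeff_def intro: less_imp_le)

text \<open>These bounds dominate the components of the adjoint, as \<open>hardy_glue\<close>
  demands in \<open>adj_Y_exists\<close>.\<close>

lemma norm_u_le: "norm (u m) \<le> 1" and norm_v_le: "norm (v m) \<le> 1"
proof -
  have "norm (u m) \<le> 1 \<and> norm (v m) \<le> 1"
  proof (cases "Suc m < D")
    case True
    then show ?thesis by (simp add: u_def v_def E_def E'_def back_w_0 back_z_0)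
  next
    case False
    define n where "n = Suc m - D"
    have m: "m = D + n - 1" using False by (simp add: n_def)
    have "0 \<le> b_par D q * (mu.szego_kappa n)\<^sup>2" "0 \<le> a_par q * (mu.szego_kappa n)\<^sup>2"
      by (simp_all add: a_par_def b_par_def)
    then have "(norm (u m))\<^sup>2 \<le> 1" "(norm (v m))\<^sup>2 \<le> (cmod (refl_coeff m))\<^sup>2"
      unfolding m norm_u norm_v by (simp_all add: mult_left_le)
    moreover have "(cmod (refl_coeff m))\<^sup>2 \<le> 1" using cmod_refl_coeff_le by (simp add: power_le_one)
    ultimately show ?thesis by (simp add: power_le_one_iff)
  qed
  then show "norm (u m) \<le> 1" "norm (v m) \<le> 1" by auto
qed

text \<open>On each degree the adjoint of f -> -<f, u> v is g -> -<g, v> u. Gluing these blocks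
  exhibits the vector that \<open>adj_on\<close> merely describes.\<close>

lemma adj_Y_exists:
  assumes g: "g \<in> Q"
  shows "\<exists>h. h \<in> Q \<and> (\<forall>d. hcomp d h = - (cinner g (v d)) *\<^sub>C u d) \<and> adj_on Q (Y_op p) g = h"
proof -
  let ?x = "\<lambda>d. - (cinner g (v d)) *\<^sub>C u d"
  have x: "hcomp d (?x d) = ?x d" for d by (simp only: hcomp_scale hcomp_u if_True simp_thms)
  have le: "norm (?x d) \<le> norm (hcomp d g)" for d
  proof -
    have "cmod (cinner g (v d)) \<le> norm (hcomp d g) * norm (v d)"
      unfolding cinner_v[of g] by (rule cinner_cauchy_schwarz)
    also have "\<dots> \<le> norm (hcomp d g)" using norm_v_le[of d] by (simp add: mult_left_le)
    finally have "cmod (cinner g (v d)) * norm (u d) \<le> norm (hcomp d g) * 1"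
      using norm_u_le[of d] by (intro mult_mono) auto
    then show ?thesis by (simp add: norm_cscale)
  qed
  obtain h where h: "\<And>d. hcomp d h = ?x d"
    using hardy_glue[of ?x g, OF x le] by blast
  have hQ: "h \<in> Q"
    by (rule Q_hcompI) (simp only: h hardy.subspace_scale[OF Q_subspace u_in_Q])
  moreover have "adj_on Q (Y_op p) g = h"
  proof (rule adj_on_eqI[OF Q_subspace hQ])
    fix f assume f: "f \<in> Q"
    show "cinner (Y_op p f) g = cinner f h"
    proof (rule cinner_eq_hcompI)
      fix d
      have "cinner (hcomp d (Y_op p f)) (hcomp d g) = - cinner f (u d) * cinner (v d) (hcomp d g)"
        by (simp only: hcomp_Y_op[OF f] cinner_simps)
      also have "cinner (v d) (hcomp d g) = cnj (cinner g (v d))"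
        by (simp only: cinner_v[of g] cinner_cnj)
      also have "- cinner f (u d) * cnj (cinner g (v d)) = cinner (hcomp d f) (hcomp d h)"
        unfolding h cinner_scale_right cinner_u[of f] by simp
      finally show "cinner (hcomp d (Y_op p f)) (hcomp d g) = cinner (hcomp d f) (hcomp d h)" .
    qed
  qed
  ultimately show ?thesis using h by blast
qed

lemma hcomp_adj_Y_Y:
  assumes f: "f \<in> Q"
  shows "hcomp d (adj_on Q (Y_op p) (Y_op p f)) = (of_real ((norm (v d))\<^sup>2) * cinner f (u d)) *\<^sub>C u d"
proof -
  have "hcomp d (adj_on Q (Y_op p) (Y_op p f)) = - (cinner (Y_op p f) (v d)) *\<^sub>C u d"
    using adj_Y_exists[OF Y_op_in_Q[OF f]] by blast
  also have "cinner (Y_op p f) (v d) = - cinner f (u d) * cinner (v d) (v d)"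
    unfolding cinner_v[of "Y_op p f"] hcomp_Y_op[OF f] cinner_scale_left ..
  finally show ?thesis by (simp add: cinner_self mult.commute)
qed

section \<open>Eigenspaces of the positive operator formed from the commutator and its
  adjoint\<close>

definition eigenspace :: "real \<Rightarrow> hardy set"
  where "eigenspace s = {f \<in> Q. adj_on Q (Y_op p) (Y_op p f) = of_real (s\<^sup>2) *\<^sub>C f}"

text \<open>The operator is block diagonal with respect to degree, so the eigenvalue equation
  decouples.\<close>

lemma eigenspace_iff:
  "f \<in> eigenspace s \<longleftrightarrow> f \<in> Q \<and>
    (\<forall>d. (of_real ((norm (v d))\<^sup>2) * cinner f (u d)) *\<^sub>C u d = of_real (s\<^sup>2) *\<^sub>C hcomp d f)"
proof (cases "f \<in> Q")
  case True
  have "adj_on Q (Y_op p) (Y_op p f) = of_real (s\<^sup>2) *\<^sub>C f \<longleftrightarrow>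
      (\<forall>d. hcomp d (adj_on Q (Y_op p) (Y_op p f)) = hcomp d (of_real (s\<^sup>2) *\<^sub>C f))"
    by (rule iffI, simp) (rule hardy_eq_hcompI, blast)
  then show ?thesis unfolding eigenspace_def hcomp_adj_Y_Y[OF True] hcomp_scale using True by simp
qed (simp add: eigenspace_def)

lemma eigenspace_subspace: "csubspace (eigenspace s)"
proof (rule hardy.subspaceI)
  show "0 \<in> eigenspace s"
    by (simp add: eigenspace_iff hardy.subspace_0[OF Q_subspace] cinner_simps hcomp_0)
next
  fix f g assume "f \<in> eigenspace s" "g \<in> eigenspace s"
  then show "f + g \<in> eigenspace s"
    by (simp add: eigenspace_iff hardy.subspace_add[OF Q_subspace] cinner_simps hcomp_add
        distrib_left hardy.scale_left_distrib hardy.scale_right_distrib del: of_real_power)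
next
  fix c f assume f: "f \<in> eigenspace s"
  show "c *\<^sub>C f \<in> eigenspace s"
    unfolding eigenspace_iff
  proof (intro conjI allI)
    fix d
    have "(of_real ((norm (v d))\<^sup>2) * cinner (c *\<^sub>C f) (u d)) *\<^sub>C u d =
        c *\<^sub>C ((of_real ((norm (v d))\<^sup>2) * cinner f (u d)) *\<^sub>C u d)"
      by (simp only: cinner_scale_left hardy.scale_scale mult.left_commute)
    also have "\<dots> = c *\<^sub>C (of_real (s\<^sup>2) *\<^sub>C hcomp d f)" using f by (simp only: eigenspace_iff)
    also have "\<dots> = of_real (s\<^sup>2) *\<^sub>C hcomp d (c *\<^sub>C f)"
      by (simp only: hcomp_scale hardy.scale_scale mult.commute)
    finally show "(of_real ((norm (v d))\<^sup>2) * cinner (c *\<^sub>C f) (u d)) *\<^sub>C u d = of_real (s\<^sup>2) *\<^sub>C hcomp d (c *\<^sub>C f)" .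
  qed (use f in \<open>simp add: eigenspace_iff hardy.subspace_scale[OF Q_subspace]\<close>)
qed

lemma u_in_eigenspace:
  assumes s: "norm (u d) * norm (v d) = s"
  shows "u d \<in> eigenspace s"
  unfolding eigenspace_iff
proof (intro conjI u_in_Q allI)
  fix e
  show "(of_real ((norm (v e))\<^sup>2) * cinner (u d) (u e)) *\<^sub>C u e = of_real (s\<^sup>2) *\<^sub>C hcomp e (u d)"
  proof (cases "e = d")
    case True
    then show ?thesis
      unfolding s[symmetric] by (simp add: hcomp_u cinner_self power_mult_distrib mult.commute)
  next
    case False
    then have "cinner (u d) (u e) = 0" by (subst cinner_u) (simp add: hcomp_u cinner_simps)
    then show ?thesis using False by (simp add: hcomp_u)
  qed
qed

text \<open>As s is positive, the equation in degree \<open>d\<close> can be solved for the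
  component, which is therefore a multiple c of \<open>u d\<close>. Pairing with \<open>u d\<close>
  once more gives c s^2 = c |u_d|^2 |v_d|^2, so c = 0 unless s is the product of the two
  norms.\<close>

lemma eigenspace_hcomp:
  assumes f: "f \<in> eigenspace s" and s: "s > 0"
  shows "\<exists>c. hcomp d f = c *\<^sub>C u d" and "norm (u d) * norm (v d) \<noteq> s \<Longrightarrow> hcomp d f = 0"
proof -
  define c where "c = of_real ((norm (v d))\<^sup>2) * cinner f (u d) / of_real (s\<^sup>2)"
  have "of_real (s\<^sup>2) *\<^sub>C hcomp d f = of_real (s\<^sup>2) *\<^sub>C (c *\<^sub>C u d)"
    using f s by (simp add: eigenspace_iff c_def)
  moreover have "complex_of_real (s\<^sup>2) \<noteq> 0" using s by simp
  ultimately have c: "hcomp d f = c *\<^sub>C u d" using hardy.scale_left_imp_eq by blast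
  then show "\<exists>c. hcomp d f = c *\<^sub>C u d" by blast
  assume ne: "norm (u d) * norm (v d) \<noteq> s"
  have "cinner f (u d) = c * of_real ((norm (u d))\<^sup>2)"
    unfolding cinner_u[of f] c cinner_scale_left cinner_self ..
  moreover have "c * of_real (s\<^sup>2) = of_real ((norm (v d))\<^sup>2) * cinner f (u d)"
    using s by (simp add: c_def)
  ultimately have "c * of_real (s\<^sup>2) = c * of_real ((norm (u d) * norm (v d))\<^sup>2)"
    by (simp add: power_mult_distrib mult_ac)
  moreover have "s\<^sup>2 \<noteq> (norm (u d) * norm (v d))\<^sup>2"
    using ne s power2_eq_iff_nonneg[of s "norm (u d) * norm (v d)"] by simp
  ultimately have "c = 0" by (simp only: mult_cancel_left of_real_eq_iff) simp
  then show "hcomp d f = 0" by (simp add: c)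
qed

section \<open>Restriction to the homogeneous components of the quotient module\<close>

lemma Q_hom_eq: "Q_hom p m = {f \<in> Q. hcomp m f = f}"
  by (auto simp: Q_hom_def H_hom_iff simp flip: Q_def)

lemma Q_hom_subspace: "csubspace (Q_hom p m)"
  unfolding Q_hom_def Q_def[symmetric]
  by (rule hardy.subspace_inter[OF Q_subspace csubspace_H_hom])

lemma closed_Q_hom: "closed (Q_hom p m)"
  unfolding Q_hom_def Q_mod_def by (intro closed_Int closed_hperp closed_H_hom)

lemma u_in_Q_hom: "u m \<in> Q_hom p m" and v_in_Q_hom: "v m \<in> Q_hom p m"
  by (simp_all add: Q_hom_eq u_in_Q v_in_Q hcomp_u hcomp_v)

lemma Q_hom_hcomp: "f \<in> Q_hom p m \<Longrightarrow> d \<noteq> m \<Longrightarrow> hcomp d f = 0"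
  using hcomp_hcomp[of d m f] by (simp add: Q_hom_eq)

lemma Q_hom_scale_imp: "f = c *\<^sub>C g \<Longrightarrow> g \<in> Q_hom p m \<Longrightarrow> f \<in> Q_hom p m"
  using hardy.subspace_scale[OF Q_hom_subspace] by blast

lemma Y_op_Q_hom:
  assumes f: "f \<in> Q_hom p m"
  shows "Y_op p f = - (cinner f (u m)) *\<^sub>C v m"
proof (rule hardy_eq_hcompI)
  fix d
  have "f \<in> Q" using f by (simp add: Q_hom_eq)
  moreover have "d \<noteq> m \<Longrightarrow> cinner f (u d) = 0"
    by (subst cinner_u) (simp add: Q_hom_hcomp[OF f] cinner_simps)
  ultimately show "hcomp d (Y_op p f) = hcomp d (- (cinner f (u m)) *\<^sub>C v m)"
    by (cases "d = m") (simp_all add: hcomp_Y_op hcomp_scale hcomp_v del: hardy.scale_minus_left)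
qed

lemma Y_op_image_Q_hom: "\<exists>k\<le>1. has_cdim (Y_op p ` Q_hom p m) k"
proof (cases "u m = 0 \<or> v m = 0")
  case True
  have "0 \<in> Q_hom p m" by (rule hardy.subspace_0[OF Q_hom_subspace])
  then have "Y_op p ` Q_hom p m = {0}"
    using True by (auto simp: Y_op_Q_hom cinner_simps image_iff)
  then have "has_cdim (Y_op p ` Q_hom p m) 0"
    unfolding has_cdim_def by (intro exI[of _ "{}"]) (simp add: hardy.span_empty hardy.independent_empty)
  then show ?thesis by blast
next
  case False
  have "Y_op p ` Q_hom p m = cspan {v m}"
  proof
    show "Y_op p ` Q_hom p m \<subseteq> cspan {v m}"
      by (auto simp only: Y_op_Q_hom hardy.span_singleton)
    show "cspan {v m} \<subseteq> Y_op p ` Q_hom p m"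
    proof
      fix g assume "g \<in> cspan {v m}"
      then obtain c where c: "g = c *\<^sub>C v m" by (auto simp: hardy.span_singleton)
      \<comment> \<open>The scalar is chosen so that -<f, u> = c.\<close>
      define f where "f = (- c / cinner (u m) (u m)) *\<^sub>C u m"
      have f: "f \<in> Q_hom p m" by (rule Q_hom_scale_imp[OF f_def u_in_Q_hom])
      have "cinner (u m) (u m) \<noteq> 0" using False by (simp add: cinner_self_eq_0)
      then have "- (cinner f (u m)) = c" by (simp add: f_def cinner_simps del: hardy.scale_minus_left)
      then have "Y_op p f = g" using Y_op_Q_hom[OF f] c by (simp only:)
      then show "g \<in> Y_op p ` Q_hom p m" using f by blast
    qed
  qed
  moreover have "\<not> cdependent {v m}" using False by (simp add: hardy.dependent_single)
  ultimately have "has_cdim (Y_op p ` Q_hom p m) 1"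
    unfolding has_cdim_def by (intro exI[of _ "{v m}"]) simp
  then show ?thesis by blast
qed

lemma reduces_Q_hom: "reduces_on Q (Y_op p) (Q_hom p m)"
  unfolding reduces_on_def
proof (intro conjI Q_hom_subspace closed_Q_hom)
  show "Q_hom p m \<subseteq> Q" by (auto simp: Q_hom_eq)
  show "Y_op p ` Q_hom p m \<subseteq> Q_hom p m"
    using Q_hom_scale_imp[OF Y_op_Q_hom v_in_Q_hom] by blast
  show "Y_op p ` (Q \<inter> hperp (Q_hom p m)) \<subseteq> Q \<inter> hperp (Q_hom p m)"
  proof (safe, rule Y_op_in_Q)
    fix f assume f: "f \<in> Q" "f \<in> hperp (Q_hom p m)"
    show "Y_op p f \<in> hperp (Q_hom p m)"
      unfolding hperp_def
    proof safe
      fix g assume g: "g \<in> Q_hom p m"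
      have "cinner f (u m) = 0" using f u_in_Q_hom by (simp add: hperp_def)
      moreover have "cinner (Y_op p f) g = cinner (hcomp m (Y_op p f)) g"
        using g by (intro cinner_component) (simp add: Q_hom_eq)
      ultimately show "cinner (Y_op p f) g = 0"
        by (simp add: hcomp_Y_op[OF f(1)] cinner_simps)
    qed
  qed
qed

text \<open>\<open>adj_on\<close> depends on the space, so singular values on a component and on
  \<open>Q\<close> refer a priori to different adjoints. They agree because the adjoint on
  \<open>Q\<close> maps the component into itself.\<close>

lemma adj_Y_Q_hom:
  assumes g: "g \<in> Q_hom p m"
  shows "adj_on (Q_hom p m) (Y_op p) g = adj_on Q (Y_op p) g"
proof (rule adj_on_eqI[OF Q_hom_subspace])
  have gQ: "g \<in> Q" using g by (simp add: Q_hom_eq)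
  from adj_Y_exists[OF gQ] have h: "adj_on Q (Y_op p) g \<in> Q"
    "\<And>d. hcomp d (adj_on Q (Y_op p) g) = - (cinner g (v d)) *\<^sub>C u d" by auto
  have eq: "adj_on Q (Y_op p) g = - (cinner g (v m)) *\<^sub>C u m"
  proof (rule hardy_eq_hcompI)
    fix d
    have "d \<noteq> m \<Longrightarrow> cinner g (v d) = 0"
      by (subst cinner_v) (simp add: Q_hom_hcomp[OF g] cinner_simps)
    then show "hcomp d (adj_on Q (Y_op p) g) = hcomp d (- (cinner g (v m)) *\<^sub>C u m)"
      by (cases "d = m") (simp_all add: h hcomp_scale hcomp_u del: hardy.scale_minus_left)
  qed
  then show "adj_on Q (Y_op p) g \<in> Q_hom p m" by (rule Q_hom_scale_imp[OF _ u_in_Q_hom])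
  fix f assume f: "f \<in> Q_hom p m"
  show "cinner (Y_op p f) g = cinner f (adj_on Q (Y_op p) g)"
    unfolding eq Y_op_Q_hom[OF f] cinner_scale_left cinner_scale_right
    by (simp add: cinner_cnj)
qed

lemma eigenspace_Q_hom:
  "{f \<in> Q_hom p m. adj_on (Q_hom p m) (Y_op p) (Y_op p f) = of_real (s\<^sup>2) *\<^sub>C f} = eigenspace s \<inter> Q_hom p m"
proof -
  have Y: "Y_op p f \<in> Q_hom p m" if "f \<in> Q_hom p m" for f
    by (rule Q_hom_scale_imp[OF Y_op_Q_hom[OF that] v_in_Q_hom])
  have "f \<in> Q" if "f \<in> Q_hom p m" for f using that by (simp add: Q_hom_eq)
  then show ?thesis
    unfolding eigenspace_def using adj_Y_Q_hom[OF Y] by auto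
qed

lemma sing_value_mult_Q_hom:
  assumes s: "s > 0"
  shows "sing_value_mult (Q_hom p (D + n - 1)) (Y_op p) s (if s = beta D p n then 1 else 0)"
proof -
  let ?m = "D + n - 1"
  \<comment> \<open>At most one degree, so \<open>has_cdim_graded\<close> returns the multiplicity 1
    or 0.\<close>
  define F where "F = (if s = beta D p n then {?m} else {})"
  have F: "d \<in> F \<longleftrightarrow> d = ?m \<and> norm (u d) * norm (v d) = s" for d
    by (auto simp: F_def beta_eq)
  have "has_cdim (eigenspace s \<inter> Q_hom p ?m) (card F)"
  proof (rule has_cdim_graded[where u = u])
    show "csubspace (eigenspace s \<inter> Q_hom p ?m)"
      by (rule hardy.subspace_inter[OF eigenspace_subspace Q_hom_subspace])
    fix f d assume f: "f \<in> eigenspace s \<inter> Q_hom p ?m"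
    then show "d \<in> F \<Longrightarrow> \<exists>c. hcomp d f = c *\<^sub>C u d" using eigenspace_hcomp(1)[OF _ s] by blast
    show "d \<notin> F \<Longrightarrow> hcomp d f = 0"
      using f eigenspace_hcomp(2)[OF _ s, of f d] Q_hom_hcomp[of f ?m d] by (auto simp: F)
  next
    show "finite F" by (simp add: F_def)
    fix d assume "d \<in> F"
    then have d: "d = ?m" "norm (u d) * norm (v d) = s" unfolding F by blast+
    show "u d \<noteq> 0" using d(2) s by auto
    show "u d \<in> eigenspace s \<inter> Q_hom p ?m"
      using u_in_eigenspace[OF d(2)] u_in_Q_hom[of d] d(1) by blast
    show "hcomp d (u d) = u d" by (simp only: hcomp_u if_True simp_thms)
  qed
  moreover have "card F = (if s = beta D p n then 1 else 0)" by (simp add: F_def)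
  ultimately show ?thesis
    unfolding sing_value_mult_def eigenspace_Q_hom by (simp only:)
qed

section \<open>Finiteness of the multiplicities\<close>

lemma kappa_bounded: "\<exists>B. \<forall>n. mu.szego_kappa n \<le> B"
proof -
  have lc: "lead_coeff q \<noteq> 0" using q_nonzero by simp
  have "mu.szego_kappa n \<le> N / cmod (lead_coeff q)" for n
  proof -
    \<comment> \<open>The true leading coefficient of \<open>q\<close> is taken here, since q_D may
      vanish and would then give no bound.\<close>
    have "coeff (q * \<phi> n) (degree q + n) = lead_coeff q * of_real (mu.szego_kappa n)"
      using coeff_mult_degree_sum[of q "\<phi> n"] by (simp add: mu.degree_szego mu.coeff_szego)
    then have "(cmod (lead_coeff q) * mu.szego_kappa n)\<^sup>2 \<le> Re (poly_inner haar_circle (q * \<phi> n) (q * \<phi> n))"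
      using coeff_le_poly_inner_haar[of "q * \<phi> n" "degree q + n"] mu.szego_kappa_pos[of n] by (simp add: norm_mult)
    also have "poly_inner haar_circle (q * \<phi> n) (q * \<phi> n) = of_real (N\<^sup>2)"
      using poly_inner_phi(1)[of n] N_pos by (simp add: poly_inner_circle_measure N_def)
    finally have "(cmod (lead_coeff q) * mu.szego_kappa n)\<^sup>2 \<le> N\<^sup>2" by simp
    then have "cmod (lead_coeff q) * mu.szego_kappa n \<le> N"
      by (rule power2_le_imp_le) (use N_pos in simp)
    then show ?thesis using lc by (simp add: pos_le_divide_eq mult.commute)
  qed
  then show ?thesis by blast
qed

text \<open>
  No Szego theorem is needed: $\rho_n = \kappa_n / \kappa_{n+1}$, and the increasing sequence $\kappa_n$ is
  bounded because $q\varphi_n$ has norm $\|q\|_2$ and leading coefficient proportional to $\kappa_n$.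
\<close>

lemma szego_alpha_tendsto_0: "(\<lambda>n. cmod (szego_alpha \<mu> n)) \<longlonglongrightarrow> 0"
proof -
  have rho_le: "szego_rho \<mu> n \<le> 1" for n by (simp add: szego_rho_def)
  have "incseq mu.szego_kappa"
  proof (rule incseq_SucI)
    fix n
    have "szego_rho \<mu> n * mu.szego_kappa (Suc n) \<le> 1 * mu.szego_kappa (Suc n)"
      using mu.szego_kappa_pos[of "Suc n"] by (intro mult_right_mono rho_le) simp
    then show "mu.szego_kappa n \<le> mu.szego_kappa (Suc n)" by (simp add: mu.szego_kappa_Suc)
  qed
  moreover obtain B where "\<forall>n. mu.szego_kappa n \<le> B" using kappa_bounded by blast
  ultimately obtain L where L: "mu.szego_kappa \<longlonglongrightarrow> L" "\<forall>n. mu.szego_kappa n \<le> L"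
    using incseq_convergent by metis
  have "L > 0" using L(2) mu.szego_kappa_pos[of 0] by (meson less_le_trans)
  have "(\<lambda>n. mu.szego_kappa n / mu.szego_kappa (Suc n)) \<longlonglongrightarrow> L / L"
    using \<open>L > 0\<close> by (intro tendsto_divide L(1) LIMSEQ_Suc[OF L(1)]) simp
  moreover have "mu.szego_kappa n / mu.szego_kappa (Suc n) = szego_rho \<mu> n" for n
    using mu.szego_kappa_Suc[of n] mu.szego_kappa_pos[of "Suc n"] by (simp add: field_simps)
  ultimately have rho: "(\<lambda>n. szego_rho \<mu> n) \<longlonglongrightarrow> 1" using \<open>L > 0\<close> by simp
  have "(\<lambda>n. sqrt (1 - (szego_rho \<mu> n)\<^sup>2)) \<longlonglongrightarrow> sqrt (1 - 1\<^sup>2)"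
    by (intro tendsto_intros rho)
  then show ?thesis by (simp add: mu.szego_rho_square)
qed

text \<open>For n >= 1, beta_n is at most |alpha_{n-1}|, which tends to 0. As \<open>card\<close> of
  an infinite set is 0, finiteness is what gives the count of indices its meaning.\<close>

lemma finite_beta:
  assumes s: "s > 0"
  shows "finite {n. beta D p n = s}"
proof -
  obtain K where K: "\<And>n. n \<ge> K \<Longrightarrow> cmod (szego_alpha \<mu> n) < s"
    using order_tendstoD(2)[OF szego_alpha_tendsto_0 s] by (auto simp: eventually_sequentially)
  have "beta D p n \<noteq> s" if "n > K" for n
  proof -
    have "norm (v (D + n - 1)) \<le> cmod (refl_coeff (D + n - 1)) * 1"
      unfolding v_def norm_cscale
    proof (rule mult_left_mono)
      have "Suc (D + n - 1) = D + n" using D_pos by simp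
      moreover have "(norm (back_z (E' (D + n))))\<^sup>2 \<le> 1\<^sup>2"
        unfolding norm_back_z_E' by (simp add: a_par_def)
      ultimately show "norm (back_z (E' (Suc (D + n - 1)))) \<le> 1"
        using power2_le_imp_le[of "norm (back_z (E' (D + n)))" 1] by simp
    qed simp
    moreover have "refl_coeff (D + n - 1) = - cnj (szego_alpha \<mu> (n - 1))"
      using that D_pos by (auto simp: refl_coeff_def)
    moreover have "cmod (szego_alpha \<mu> (n - 1)) < s" using that by (intro K) simp
    ultimately have "norm (v (D + n - 1)) < s" by simp
    moreover have "beta D p n \<le> 1 * norm (v (D + n - 1))"
      unfolding beta_eq by (intro mult_right_mono norm_u_le) simp
    ultimately show ?thesis by simp
  qed
  then have "{n. beta D p n = s} \<subseteq> {..K}" using not_less by blast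
  then show ?thesis by (rule finite_subset) simp
qed

lemma sing_value_mult_Q:
  assumes s: "s > 0"
  shows "sing_value_mult Q (Y_op p) s (card {n. beta D p n = s})"
proof -
  define F where "F = (\<lambda>n. D + n - 1) ` {n. beta D p n = s}"
  have F: "d \<in> F \<longleftrightarrow> norm (u d) * norm (v d) = s" for d
  proof
    assume d: "norm (u d) * norm (v d) = s"
    then have "u d \<noteq> 0" using s by auto
    then have "\<not> Suc d < D" using u_small by blast
    \<comment> \<open>Below degree D - 1 the vector \<open>u d\<close> vanishes, so each degree with
      a non-zero block comes from the index \<open>Suc d - D\<close>.\<close>
    then have "d = D + (Suc d - D) - 1" by simp
    with d show "d \<in> F" unfolding F_def by (intro image_eqI[of _ _ "Suc d - D"]) (auto simp: beta_eq)
  qed (auto simp: F_def beta_eq)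
  have "inj_on (\<lambda>n. D + n - 1) {n. beta D p n = s}"
    using D_pos by (auto simp: inj_on_def)
  then have "card F = card {n. beta D p n = s}" unfolding F_def by (rule card_image)
  moreover have "has_cdim (eigenspace s) (card F)"
  proof (rule has_cdim_graded[where u = u])
    show "finite F" using finite_beta[OF s] by (simp add: F_def)
    fix f d assume f: "f \<in> eigenspace s"
    show "\<exists>c. hcomp d f = c *\<^sub>C u d" by (rule eigenspace_hcomp(1)[OF f s])
    show "d \<notin> F \<Longrightarrow> hcomp d f = 0" using eigenspace_hcomp(2)[OF f s] by (simp add: F)
  qed (use s in \<open>auto simp: F hcomp_u u_in_eigenspace eigenspace_subspace\<close>)
  ultimately show ?thesis
    by (simp add: sing_value_mult_def eigenspace_def)
qed

section \<open>Degrees below D - 1\<close>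

lemma low_degree_in_Q: "cspan (\<Union>m\<in>{m. m + 2 \<le> D}. H_hom m) \<subseteq> Q"
proof (rule hardy.span_minimal[OF _ Q_subspace], rule UN_least)
  fix m assume m: "m \<in> {m. m + 2 \<le> D}"
  show "H_hom m \<subseteq> Q"
  proof
    fix f assume "f \<in> H_hom m"
    then show "f \<in> Q" using hcomp_in_Q_small[of m f] m by (simp add: H_hom_iff)
  qed
qed

text \<open>Such an \<open>f\<close> has no component of degree D - 1 or more, while
  \<open>u d\<close> vanishes in all smaller degrees. The condition \<open>D \<le> Suc d\<close>
  expresses d >= D - 1 without subtraction.\<close>

lemma Y_op_low_degree:
  assumes f: "f \<in> cspan (\<Union>m\<in>{m. m + 2 \<le> D}. H_hom m)"
  shows "Y_op p f = 0"
proof -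
  let ?V = "{f. \<forall>d. D \<le> Suc d \<longrightarrow> hcomp d f = 0}"
  have "csubspace ?V"
    by (auto simp: hardy.subspace_def hcomp_0 hcomp_add hcomp_scale)
  moreover have "(\<Union>m\<in>{m. m + 2 \<le> D}. H_hom m) \<subseteq> ?V"
  proof safe
    fix m f d assume "m + 2 \<le> D" "f \<in> H_hom m" "D \<le> Suc d"
    then show "hcomp d f = 0" using hcomp_hcomp[of d m f] by (auto simp: H_hom_iff)
  qed
  ultimately have "cspan (\<Union>m\<in>{m. m + 2 \<le> D}. H_hom m) \<subseteq> ?V" by (rule hardy.span_minimal[rotated])
  then have V: "D \<le> Suc d \<Longrightarrow> hcomp d f = 0" for d using f by blast
  have fQ: "f \<in> Q" using f low_degree_in_Q by blast
  show ?thesis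
  proof (rule hardy_eq_hcompI)
    fix d
    have "cinner f (u d) = 0"
    proof (cases "Suc d < D")
      case True
      then show ?thesis by (simp add: u_small cinner_simps)
    next
      case False
      then show ?thesis by (subst cinner_u) (simp add: V cinner_simps)
    qed
    then show "hcomp d (Y_op p f) = hcomp d 0" by (simp add: hcomp_Y_op[OF fQ] hcomp_0)
  qed
qed

end

theorem theorem6p4:
  fixes p :: "complex poly poly" and D :: nat
  assumes "p \<noteq> 0" and "homogeneous_poly p D" and "D \<ge> 1"
  shows
    "cspan (\<Union>m\<in>{m. m + 2 \<le> D}. H_hom m) \<subseteq> Q_mod p \<and>
     (\<forall>f \<in> cspan (\<Union>m\<in>{m. m + 2 \<le> D}. H_hom m). Y_op p f = 0) \<and>
     (\<forall>n. reduces_on (Q_mod p) (Y_op p) (Q_hom p (D + n - 1)) \<and>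
          (\<exists>k\<le>1. has_cdim (Y_op p ` Q_hom p (D + n - 1)) k) \<and>
          radicand D (poly p 1) n \<ge> 0 \<and>
          (\<forall>s>0. sing_value_mult (Q_hom p (D + n - 1)) (Y_op p) s
                   (if s = beta D p n then 1 else 0))) \<and>
     (\<forall>s>0. finite {n. beta D p n = s} \<and>
            sing_value_mult (Q_mod p) (Y_op p) s (card {n. beta D p n = s}))"
proof -
  interpret homogeneous_symbol p D by unfold_locales (fact assms)+
  show ?thesis
    unfolding Q_def[symmetric] q_def[symmetric]
    using low_degree_in_Q Y_op_low_degree reduces_Q_hom Y_op_image_Q_hom radicand_nonneg
      sing_value_mult_Q_hom finite_beta sing_value_mult_Q
    by blast
qed

end
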